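(* There is an algorithm which, given a finite set $W$, an integer $k$ with $1\le k<|W|$ (both part of the input), and access to an independence oracle of a binary $k$-matroid $(W,\mathcal{H})$, decides whether $(W,\mathcal{H})$ is separable in time polynomial in $|W|$, and in particular using a number of oracle queries polynomial in $|W|$.
   Context: A $k$-hypergraph is a pair $(W,\mathcal{H})$ with $W$ a finite set and $\mathcal{H}$ a set of $k$-element subsets of $W$. It is separable if there is a labeling $x:W\to\mathbb{R}$ such that, with $x(E):=\sum_{v\in E}x(v)$, $\mathcal{H}=\{E\subseteq W:|E|=k,\ x(E)\ge 0\}$. A $k$-matroid is a $k$-hypergraph $(W,\mathcal{H})$ with $\mathcal{H}\ne\emptyset$ such that for every $E_1,E_2\in\mathcal{H}$ and $v_1\in E_1\setminus E_2$ there is $v_2\in E_2\setminus E_1$ with $(E_1\setminus\{v_1\})\cup\{v_2\}\in\mathcal{H}$ (that is, $\mathcal{H}$ is the set of bases of a rank $k$ matroid on $W$). A set $I\subseteq W$ is independent if $I\subseteq E$ for some $E\in\mathcal{H}$. A circuit is a subset of $W$ which is not independent but all of whose proper subsets are independent. The matroid is binary if for any two distinct circuits $C_1,C_2$, the symmetric difference $C_1\Delta C_2$ is a disjoint union of circuits. An independence oracle for $(W,\mathcal{H})$, queried on any subset $I\subseteq W$, answers YES if $I$ is independent and NO otherwise; each query counts as one step, and $\mathcal{H}$ is accessed only through the oracle. *)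

theory Defs
  imports Complex_Main "HOL-Computational_Algebra.Polynomial"
begin

section \<open>Hypergraphs and matroids\<close>

definition k_hypergraph :: "nat \<Rightarrow> 'a set \<Rightarrow> 'a set set \<Rightarrow> bool" where
  "k_hypergraph k W H \<longleftrightarrow> finite W \<and> (\<forall>E\<in>H. E \<subseteq> W \<and> card E = k)"

definition separable_hypergraph :: "nat \<Rightarrow> 'a set \<Rightarrow> 'a set set \<Rightarrow> bool" where
  "separable_hypergraph k W H \<longleftrightarrow>
     (\<exists>x :: 'a \<Rightarrow> real. H = {E. E \<subseteq> W \<and> card E = k \<and> (\<Sum>v\<in>E. x v) \<ge> 0})"

definition k_matroid :: "nat \<Rightarrow> 'a set \<Rightarrow> 'a set set \<Rightarrow> bool" where
  "k_matroid k W H \<longleftrightarrow> k_hypergraph k W H \<and> H \<noteq> {} \<and>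
     (\<forall>E1\<in>H. \<forall>E2\<in>H. \<forall>v1\<in>E1 - E2. \<exists>v2\<in>E2 - E1. (E1 - {v1}) \<union> {v2} \<in> H)"

definition indep_set :: "'a set set \<Rightarrow> 'a set \<Rightarrow> bool" where
  "indep_set H I \<longleftrightarrow> (\<exists>E\<in>H. I \<subseteq> E)"

definition circuit :: "'a set \<Rightarrow> 'a set set \<Rightarrow> 'a set \<Rightarrow> bool" where
  "circuit W H C \<longleftrightarrow> C \<subseteq> W \<and> \<not> indep_set H C \<and> (\<forall>D. D \<subset> C \<longrightarrow> indep_set H D)"

definition binary_matroid :: "'a set \<Rightarrow> 'a set set \<Rightarrow> bool" where
  "binary_matroid W H \<longleftrightarrow>
     (\<forall>C1 C2. circuit W H C1 \<and> circuit W H C2 \<and> C1 \<noteq> C2 \<longrightarrow>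
        (\<exists>F. (\<forall>C\<in>F. circuit W H C) \<and> pairwise disjnt F \<and> \<Union>F = (C1 - C2) \<union> (C2 - C1)))"


section \<open>Oracle random access machines\<close>

text \<open>
  Algorithms are programs for a random access machine with unit-cost instructions: a machine
  has registers, directly addressed by the program, and an unbounded memory, addressed through
  registers; both hold natural numbers. Addition and truncated subtraction are the only
  arithmetic, so the bit length of the stored numbers is linear in the number of steps and the input length, and
  polynomial time on this machine is polynomial time on a Turing machine.
  A program is a finite object that does not depend on the input.

  The oracle is a Boolean function of a set of natural numbers. The instruction
  \<open>Query d a\<close> presents to it the set whose characteristic vector is stored in memory starting
  from the address in register \<open>a\<close>, where a nonzero entry means membership.
\<close>

datatype com =
    Skip
  | Const nat nat         \<comment> \<open>\<open>Const d c\<close>: \<open>reg d := c\<close>\<close>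
  | Move nat nat          \<comment> \<open>\<open>Move d a\<close>: \<open>reg d := reg a\<close>\<close>
  | Add nat nat nat       \<comment> \<open>\<open>Add d a b\<close>: \<open>reg d := reg a + reg b\<close>\<close>
  | Sub nat nat nat       \<comment> \<open>\<open>Sub d a b\<close>: \<open>reg d := reg a - reg b\<close>, truncated\<close>
  | Load nat nat          \<comment> \<open>\<open>Load d a\<close>: \<open>reg d := mem (reg a)\<close>\<close>
  | Store nat nat         \<comment> \<open>\<open>Store a b\<close>: \<open>mem (reg a) := reg b\<close>\<close>
  | Query nat nat         \<comment> \<open>\<open>Query d a\<close>: \<open>reg d := 1\<close> or \<open>0\<close>, the answer of the oracle\<close>
  | Seq com com
  | Cond nat com com      \<comment> \<open>test whether the register is nonzero\<close>
  | While nat com         \<comment> \<open>loop as long as the register is nonzero\<close>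

type_synonym state = "(nat \<Rightarrow> nat) \<times> (nat \<Rightarrow> nat)"  \<comment> \<open>registers and memory\<close>

text \<open>
  \<open>exec orc c s t q s'\<close>: with oracle \<open>orc\<close>, program \<open>c\<close> started in state \<open>s\<close> halts in
  state \<open>s'\<close> after \<open>t\<close> steps, \<open>q\<close> of which are oracle queries. Every instruction and every
  evaluation of a test is one step.
\<close>

inductive exec :: "(nat set \<Rightarrow> bool) \<Rightarrow> com \<Rightarrow> state \<Rightarrow> nat \<Rightarrow> nat \<Rightarrow> state \<Rightarrow> bool"
  for orc :: "nat set \<Rightarrow> bool"
where
  Skip: "exec orc Skip s 1 0 s"
| Const: "exec orc (Const d c) (r, m) 1 0 (r(d := c), m)"
| Move: "exec orc (Move d a) (r, m) 1 0 (r(d := r a), m)"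
| Add: "exec orc (Add d a b) (r, m) 1 0 (r(d := r a + r b), m)"
| Sub: "exec orc (Sub d a b) (r, m) 1 0 (r(d := r a - r b), m)"
| Load: "exec orc (Load d a) (r, m) 1 0 (r(d := m (r a)), m)"
| Store: "exec orc (Store a b) (r, m) 1 0 (r, m(r a := r b))"
| Query: "exec orc (Query d a) (r, m) 1 1
            (r(d := (if orc {i. m (r a + i) \<noteq> 0} then 1 else 0)), m)"
| Seq: "exec orc c1 s t1 q1 s1 \<Longrightarrow> exec orc c2 s1 t2 q2 s2
          \<Longrightarrow> exec orc (Seq c1 c2) s (t1 + t2) (q1 + q2) s2"
| CondTrue: "fst s b \<noteq> 0 \<Longrightarrow> exec orc c1 s t q s'
          \<Longrightarrow> exec orc (Cond b c1 c2) s (1 + t) q s'"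
| CondFalse: "fst s b = 0 \<Longrightarrow> exec orc c2 s t q s'
          \<Longrightarrow> exec orc (Cond b c1 c2) s (1 + t) q s'"
| WhileFalse: "fst s b = 0 \<Longrightarrow> exec orc (While b c) s 1 0 s"
| WhileTrue: "fst s b \<noteq> 0 \<Longrightarrow> exec orc c s t1 q1 s1 \<Longrightarrow> exec orc (While b c) s1 t2 q2 s2
          \<Longrightarrow> exec orc (While b c) s (1 + t1 + t2) (q1 + q2) s2"

inductive_cases exec_SkipE: "exec orc (Skip) s t q s'"
inductive_cases exec_ConstE: "exec orc (Const d c) s t q s'"
inductive_cases exec_MoveE: "exec orc (Move d a) s t q s'"
inductive_cases exec_AddE: "exec orc (Add d a b) s t q s'"
inductive_cases exec_SubE: "exec orc (Sub d a b) s t q s'"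
inductive_cases exec_LoadE: "exec orc (Load d a) s t q s'"
inductive_cases exec_StoreE: "exec orc (Store a b) s t q s'"
inductive_cases exec_QueryE: "exec orc (Query d a) s t q s'"
inductive_cases exec_SeqE: "exec orc (Seq c1 c2) s t q s'"
inductive_cases exec_CondE: "exec orc (Cond b c1 c2) s t q s'"
inductive_cases exec_WhileE: "exec orc (While b c) s t q s'"

lemma exec_deterministic:
  "exec orc c s t q s' \<Longrightarrow> exec orc c s u p s'' \<Longrightarrow> u = t \<and> p = q \<and> s'' = s'"
proof (induction arbitrary: u p s'' rule: exec.induct)
  case (Seq c1 s t1 q1 s1 c2 t2 q2 s2)
  from Seq.prems show ?case by (rule exec_SeqE) (metis Seq.IH)
next
  case (WhileTrue s b c t1 q1 s1 t2 q2 s2)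
  from WhileTrue.prems show ?case
  proof (rule exec_WhileE)
    assume "fst s b = 0"
    with WhileTrue.hyps show ?case by simp
  next
    fix t1' q1' s1' t2' q2'
    assume *: "u = Suc (t1' + t2')" "p = q1' + q2'"
      and "exec orc c s t1' q1' s1'" "exec orc (While b c) s1' t2' q2' s''"
    with WhileTrue.IH have "t1' = t1 \<and> q1' = q1 \<and> t2' = t2 \<and> q2' = q2 \<and> s'' = s2"
      by metis
    with * show ?case by simp
  qed
next
  case (WhileFalse s b c)
  from WhileFalse.prems show ?case
    by (rule exec_WhileE) (use WhileFalse.hyps in simp_all)
next
  case (CondTrue s b c1 t q s' c2)
  from CondTrue.prems show ?case
    by (rule exec_CondE) (use CondTrue.hyps in \<open>auto dest: CondTrue.IH\<close>)
next
  case (CondFalse s b c2 t q s' c1)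
  from CondFalse.prems show ?case
    by (rule exec_CondE) (use CondFalse.hyps in \<open>auto dest: CondFalse.IH\<close>)
qed (auto elim: exec_SkipE exec_ConstE exec_MoveE exec_AddE exec_SubE exec_LoadE exec_StoreE exec_QueryE)

text \<open>
  A finite set \<open>W\<close> is handed to a program by listing its elements in some order: element
  \<open>ws ! i\<close> is known to the program only as the number \<open>i\<close>. The input consists of
  \<open>|W|\<close> in register 0 and \<open>k\<close> in register 1; everything else is initially 0.
  The family of bases is accessed only through the oracle, which ignores numbers that are not
  positions of the list.
\<close>

definition independence_oracle :: "'a list \<Rightarrow> 'a set set \<Rightarrow> nat set \<Rightarrow> bool" where
  "independence_oracle ws H I \<longleftrightarrow> indep_set H {ws ! i | i. i \<in> I \<and> i < length ws}"

definition input :: "nat \<Rightarrow> nat \<Rightarrow> state" where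
  "input n k = ((\<lambda>_. 0)(0 := n, 1 := k), \<lambda>_. 0)"

definition answer :: "state \<Rightarrow> nat" where
  "answer s = fst s 0"

end

theory Submission imports Defs
begin

text \<open>
  Fix a basis \<open>B\<close>. Its fundamental graph joins \<open>b \<in> B\<close> and \<open>e \<notin> B\<close> if exchanging \<open>b\<close> for \<open>e\<close>
  gives a basis again. The theorem rests on a characterization: a binary matroid is separable
  iff this graph, after deletion of isolated vertices, is either complete bipartite or a double
  star, that is, it has an edge that meets all other edges (lemma \<open>separable_iff_shape\<close>).

  Two pairs of sets with the same multiset union have the same total weight, so in a separable matroid
  two bases cannot be traded for two non-bases of size \<open>k\<close> (\<open>no_trade\<close>). One such trade shows that the neighbourhoods \<open>D e = {b. b ~ e}\<close> of elements
  outside \<open>B\<close> form a chain. In a binary matroid the fundamental circuits \<open>D e \<union> {e}\<close> and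
  \<open>D f \<union> {f}\<close> have a dependent symmetric difference, which yields further non-bases. Two
  more trades then show that a nonempty neighbourhood strictly contained in another is a singleton
  (\<open>smaller_is_singleton\<close>), and that only one element has the larger neighbourhood
  (\<open>larger_is_unique\<close>). A graph that is not complete bipartite is therefore a double star.

  Conversely, in both cases \<open>W\<close> splits into coloops \<open>C\<close>, a set \<open>A\<close>, a class \<open>P\<close> of parallel
  elements and loops, such that the bases are \<open>C \<union> A\<close> and the sets that replace one
  element of \<open>A\<close> by one of \<open>P\<close>. The weights 2, 1, 0, -2 on these four parts, shifted
  by a constant, separate (\<open>separable_by_parts\<close>).

  The algorithm finds \<open>B\<close> greedily with one query per element. The shape of the fundamental
  graph is a first-order property, with quantifiers over the \<open>n\<close> elements and with a single
  query deciding an edge. Compiling quantifiers to loops evaluates any fixed formula of this kind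
  in polynomial time (\<open>halts_compile\<close>); as every query is a step, the bound on the time bounds
  the queries too.
\<close>

section \<open>Bases and exchange\<close>

lemma k_matroidD:
  assumes "k_matroid k W H" "E \<in> H"
  shows "E \<subseteq> W" "card E = k" "finite E" "finite W"
proof -
  show *: "E \<subseteq> W" "card E = k" "finite W" using assms unfolding k_matroid_def k_hypergraph_def by auto
  show "finite E" using * by (rule_tac finite_subset)
qed

lemma basis_exchange:
  assumes "k_matroid k W H" "E1 \<in> H" "E2 \<in> H" "v \<in> E1 - E2"
  shows "\<exists>u. u \<in> E2 - E1 \<and> insert u (E1 - {v}) \<in> H"
proof -
  from assms have "\<exists>u\<in>E2 - E1. (E1 - {v}) \<union> {u} \<in> H" unfolding k_matroid_def by blast
  then show ?thesis by auto
qed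

text \<open>
  A basis \<open>E\<close> containing \<open>I\<close> can be moved towards \<open>B\<close>, since an element of \<open>E\<close>
  outside \<open>I \<union> B\<close> can be exchanged for one of \<open>B\<close>.
\<close>

lemma extend_within:
  assumes M: "k_matroid k W H" and B: "B \<in> H"
  shows "E \<in> H \<Longrightarrow> I \<subseteq> E \<Longrightarrow> \<exists>E'\<in>H. I \<subseteq> E' \<and> E' \<subseteq> I \<union> B"
proof (induction "card (E - B)" arbitrary: E rule: less_induct)
  case less
  show ?case
  proof (cases "E \<subseteq> I \<union> B")
    case True
    with less.prems show ?thesis by (intro bexI[of _ E] conjI)
  next
    case False
    then obtain v where v: "v \<in> E" "v \<notin> I" "v \<notin> B" by blast
    then obtain u where u: "u \<in> B - E" "insert u (E - {v}) \<in> H"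
      using basis_exchange[OF M less.prems(1) B, of v] by auto
    have "insert u (E - {v}) - B \<subset> E - B" using u(1) v by auto
    then have "card (insert u (E - {v}) - B) < card (E - B)"
      using k_matroidD(3)[OF M less.prems(1)] by (intro psubset_card_mono) auto
    moreover have "I \<subseteq> insert u (E - {v})" using v(2) less.prems(2) by auto
    ultimately show ?thesis by (rule less.hyps[OF _ u(2)])
  qed
qed

lemma card_swap:
  assumes "finite B" "b \<in> B" "e \<notin> B"
  shows "card (insert e (B - {b})) = card B"
  using assms by (metis DiffD1 card_Suc_Diff1 card_insert_disjoint finite_Diff)

text \<open>
  The form in which \<open>extend_within\<close> is applied: the basis obtained inside \<open>B \<union> {e}\<close> omits exactly
  one element of \<open>B\<close>, which lies outside \<open>I\<close>.
\<close>

lemma exchange_keeping: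
  assumes M: "k_matroid k W H" and B: "B \<in> H" and I: "I \<subseteq> B" and e: "e \<notin> B"
    and ind: "indep_set H (insert e I)"
  obtains b where "b \<in> B - I" "insert e (B - {b}) \<in> H"
proof -
  from ind obtain E where "E \<in> H" "insert e I \<subseteq> E" unfolding indep_set_def by blast
  from extend_within[OF M B this] obtain E'
    where E': "E' \<in> H" "insert e I \<subseteq> E'" "E' \<subseteq> insert e B" using I by blast
  have fin: "finite B" "finite E'" "card E' = card B" "card B = k"
    using k_matroidD[OF M] B E' by auto
  have "\<not> insert e B \<subseteq> E'"
  proof
    assume "insert e B \<subseteq> E'"
    from card_mono[OF fin(2) this] show False using fin e by simp
  qed
  then obtain b where b: "b \<in> B" "b \<notin> E'" using E' by blast
  have "E' = insert e (B - {b})"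
  proof (rule card_subset_eq)
    show "E' \<subseteq> insert e (B - {b})" using E' b by blast
    show "card E' = card (insert e (B - {b}))"
      using fin card_swap[OF fin(1) b(1) e] by simp
  qed (use fin in auto)
  then show thesis using that[of b] b E' by blast
qed

section \<open>The fundamental graph of a basis\<close>

definition fundamental_edge :: "'a set set \<Rightarrow> 'a set \<Rightarrow> 'a \<Rightarrow> 'a \<Rightarrow> bool" where
  "fundamental_edge H B b e \<longleftrightarrow> b \<in> B \<and> e \<notin> B \<and> insert e (B - {b}) \<in> H"

definition complete_edges :: "'a set set \<Rightarrow> 'a set \<Rightarrow> bool" where
  "complete_edges H B \<longleftrightarrow>
     (\<forall>b e b' e'. fundamental_edge H B b e \<longrightarrow> fundamental_edge H B b' e' \<longrightarrow> fundamental_edge H B b e')"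

definition double_star :: "'a set set \<Rightarrow> 'a set \<Rightarrow> bool" where
  "double_star H B \<longleftrightarrow>
     (\<exists>p a. fundamental_edge H B p a \<and> (\<forall>b e. fundamental_edge H B b e \<longrightarrow> b = p \<or> e = a))"

lemma fundamental_circuit:
  assumes M: "k_matroid k W H" and B: "B \<in> H" and e: "e \<in> W - B"
  shows "circuit W H (insert e {b. fundamental_edge H B b e})"
  unfolding circuit_def
proof (intro conjI allI impI)
  show "insert e {b. fundamental_edge H B b e} \<subseteq> W"
    using k_matroidD[OF M B] e by (auto simp: fundamental_edge_def)
  show "\<not> indep_set H (insert e {b. fundamental_edge H B b e})"
  proof
    assume "indep_set H (insert e {b. fundamental_edge H B b e})"
    moreover have "{b. fundamental_edge H B b e} \<subseteq> B" by (auto simp: fundamental_edge_def)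
    ultimately obtain b where "b \<in> B - {b. fundamental_edge H B b e}" "insert e (B - {b}) \<in> H"
      using exchange_keeping[OF M B] e by (metis DiffD2)
    then show False using e by (auto simp: fundamental_edge_def)
  qed
  fix D assume D: "D \<subset> insert e {b. fundamental_edge H B b e}"
  show "indep_set H D"
  proof (cases "e \<in> D")
    case False
    then have "D \<subseteq> B" using D by (auto simp: fundamental_edge_def)
    then show ?thesis using B by (auto simp: indep_set_def)
  next
    case True
    then obtain b where b: "fundamental_edge H B b e" "b \<notin> D" using D by blast
    then have "D \<subseteq> insert e (B - {b})" using D by (auto simp: fundamental_edge_def)
    then show ?thesis using b by (auto simp: indep_set_def fundamental_edge_def)
  qed
qed

text \<open>
  The only use of binarity. The symmetric difference of the fundamental circuits of \<open>e\<close> and \<open>f\<close>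
  is a nonempty disjoint union of circuits, hence dependent. The inclusion of the neighbourhood of
  \<open>f\<close> in that of \<open>e\<close> holds wherever this is applied and leaves only one difference to describe.
\<close>

lemma binary_dependent:
  assumes M: "k_matroid k W H" and bin: "binary_matroid W H" and B: "B \<in> H"
    and e: "e \<in> W - B" and f: "f \<in> W - B" and ne: "e \<noteq> f"
    and sub: "\<And>b. fundamental_edge H B b f \<Longrightarrow> fundamental_edge H B b e"
    and S: "e \<in> S" "f \<in> S" "\<And>b. fundamental_edge H B b e \<Longrightarrow> \<not> fundamental_edge H B b f \<Longrightarrow> b \<in> S"
  shows "S \<notin> H"
proof
  assume SH: "S \<in> H"
  let ?C = "insert e {b. fundamental_edge H B b e}" and ?D = "insert f {b. fundamental_edge H B b f}"
  have "?C \<noteq> ?D" using ne f by (auto simp: fundamental_edge_def)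
  then obtain F where F: "\<forall>C\<in>F. circuit W H C" "\<Union>F = (?C - ?D) \<union> (?D - ?C)"
    using bin fundamental_circuit[OF M B e] fundamental_circuit[OF M B f]
    unfolding binary_matroid_def by meson
  have "e \<in> \<Union>F" using F(2) ne e by (auto simp: fundamental_edge_def)
  then obtain C where C: "C \<in> F" by blast
  have "\<Union>F \<subseteq> S" unfolding F(2) using S sub by auto
  then have "indep_set H C" using C SH by (auto simp: indep_set_def)
  then show False using F(1) C by (auto simp: circuit_def)
qed

section \<open>Separability forces the shape\<close>

text \<open>
  The bases have nonnegative weight, hence so has one of \<open>F1\<close> and \<open>F2\<close>. Demanding equal sums for
  every weight function says that the two pairs have the same multiset union.
\<close>

lemma no_trade:
  assumes sep: "separable_hypergraph k W H" and "E1 \<in> H" "E2 \<in> H"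
    and "F1 \<subseteq> W" "F2 \<subseteq> W" "card F1 = k" "card F2 = k"
    and "\<And>x :: 'a \<Rightarrow> real. sum x E1 + sum x E2 = sum x F1 + sum x F2"
  shows "F1 \<in> H \<or> F2 \<in> H"
proof -
  from sep obtain x :: "'a \<Rightarrow> real"
    where H: "H = {E. E \<subseteq> W \<and> card E = k \<and> (\<Sum>v\<in>E. x v) \<ge> 0}"
    unfolding separable_hypergraph_def by blast
  have "sum x E1 \<ge> 0" "sum x E2 \<ge> 0" using assms(2,3) H by auto
  then have "sum x F1 \<ge> 0 \<or> sum x F2 \<ge> 0" using assms(8)[of x] by linarith
  then show ?thesis using H assms by auto
qed

lemma sum_swap:
  fixes x :: "'a \<Rightarrow> real"
  assumes "finite B" "b \<in> B" "e \<notin> B"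
  shows "sum x (insert e (B - {b})) = sum x B - x b + x e"
  using assms by (simp add: sum_diff1)

lemma sum_swap2:
  fixes x :: "'a \<Rightarrow> real"
  assumes "finite B" "b \<in> B" "e \<notin> B" "b' \<in> B" "e' \<notin> B" "b \<noteq> b'" "e \<noteq> e'"
  shows "sum x (insert e (insert e' (B - {b, b'}))) = sum x B - x b - x b' + x e + x e'"
proof -
  have "B - {b, b'} = (B - {b}) - {b'}" by blast
  then show ?thesis using assms by (simp add: sum_diff1)
qed

lemma card_swap2:
  assumes "finite B" "b \<in> B" "e \<notin> B" "b' \<in> B" "e' \<notin> B" "b \<noteq> b'" "e \<noteq> e'"
  shows "card (insert e (insert e' (B - {b, b'}))) = card B"
  using sum_swap2[OF assms, of "\<lambda>_. 1"] by simp

text \<open>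
  Neighbourhoods form a chain: edges \<open>be\<close> and \<open>b'e'\<close> with both \<open>be'\<close> and \<open>b'e\<close> missing would
  trade the bases \<open>B - b + e\<close> and \<open>B - b' + e'\<close> for two non-bases.
\<close>

lemma edge_nested:
  assumes M: "k_matroid k W H" and sep: "separable_hypergraph k W H" and B: "B \<in> H"
    and b: "fundamental_edge H B b e" "\<not> fundamental_edge H B b e'" and e': "e' \<in> W - B" and b': "fundamental_edge H B b' e'"
  shows "fundamental_edge H B b' e"
proof (rule ccontr)
  assume n: "\<not> fundamental_edge H B b' e"
  have fin: "finite B" "card B = k" "B \<subseteq> W" using k_matroidD[OF M B] by auto
  have in_B: "b \<in> B" "b' \<in> B" "e \<notin> B" "e' \<notin> B" using b b' by (auto simp: fundamental_edge_def)
  have H: "insert e (B - {b}) \<in> H" "insert e' (B - {b'}) \<in> H" using b b' by (auto simp: fundamental_edge_def)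
  have "e \<in> W" using k_matroidD(1)[OF M H(1)] by auto
  then have "insert e' (B - {b}) \<in> H \<or> insert e (B - {b'}) \<in> H"
    using H in_B fin e' card_swap[of B b e'] card_swap[of B b' e]
    by (intro no_trade[OF sep H]) (auto simp: sum_swap)
  then show False using b n in_B by (auto simp: fundamental_edge_def)
qed

text \<open>
  Exchanging \<open>b\<close> in the basis \<open>B - b' + e'\<close> for an element of \<open>B - b + e\<close> leaves \<open>b'\<close> and
  \<open>e\<close> as candidates, and \<open>b'\<close> would make \<open>be'\<close> an edge.
\<close>

lemma double_exchange:
  assumes M: "k_matroid k W H" and b: "fundamental_edge H B b e" "\<not> fundamental_edge H B b e'" and b': "fundamental_edge H B b' e'"
  shows "insert e (insert e' (B - {b, b'})) \<in> H"
proof -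
  have in_B: "b \<in> B" "b' \<in> B" "e \<notin> B" "e' \<notin> B" and ne: "b \<noteq> b'" "e \<noteq> e'"
    and H: "insert e' (B - {b'}) \<in> H" "insert e (B - {b}) \<in> H"
    using b b' by (auto simp: fundamental_edge_def)
  have "b \<in> insert e' (B - {b'}) - insert e (B - {b})" using in_B ne by auto
  from basis_exchange[OF M H this] obtain u where
    u: "u \<in> insert e (B - {b}) - insert e' (B - {b'})" "insert u (insert e' (B - {b'}) - {b}) \<in> H"
    by auto
  have "u = b' \<or> u = e" using u(1) by auto
  moreover have "insert b' (insert e' (B - {b'}) - {b}) = insert e' (B - {b})"
    using in_B ne by auto
  moreover have "insert e (insert e' (B - {b'}) - {b}) = insert e (insert e' (B - {b, b'}))"
    using in_B ne by auto
  ultimately show ?thesis using u(2) b(2) in_B by (auto simp: fundamental_edge_def)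
qed

text \<open>
  Were \<open>b'\<close> and \<open>b''\<close> distinct, the set \<open>Y = B - b' - b'' + e + e'\<close> would be dependent by
  binarity, and the bases \<open>B - b' + e'\<close> and \<open>B - b - b'' + e + e'\<close> would be traded for the
  non-bases \<open>B - b + e'\<close> and \<open>Y\<close>.
\<close>

lemma smaller_is_singleton:
  assumes M: "k_matroid k W H" and bin: "binary_matroid W H" and sep: "separable_hypergraph k W H"
    and B: "B \<in> H" and b: "fundamental_edge H B b e" "\<not> fundamental_edge H B b e'"
    and b': "fundamental_edge H B b' e'" and b'': "fundamental_edge H B b'' e'"
  shows "b' = b''"
proof (rule ccontr)
  assume ne: "b' \<noteq> b''"
  have fin: "finite B" "card B = k" "B \<subseteq> W" using k_matroidD[OF M B] by auto
  have in_B: "b \<in> B" "b' \<in> B" "b'' \<in> B" "e \<notin> B" "e' \<notin> B" and ne': "b \<noteq> b'" "b \<noteq> b''" "e \<noteq> e'"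
    and H: "insert e' (B - {b'}) \<in> H" "insert e (B - {b}) \<in> H"
    using b b' b'' by (auto simp: fundamental_edge_def)
  have W: "e \<in> W - B" "e' \<in> W - B" using k_matroidD(1)[OF M] H in_B by auto
  let ?Y = "insert e (insert e' (B - {b', b''}))"
  have "?Y \<notin> H"
    using edge_nested[OF M sep B b W(2)] b' b''
    by (intro binary_dependent[OF M bin B W \<open>e \<noteq> e'\<close>]) (auto simp: fundamental_edge_def)
  moreover have "insert e' (B - {b}) \<notin> H" using b in_B by (auto simp: fundamental_edge_def)
  moreover have "insert e' (B - {b}) \<in> H \<or> ?Y \<in> H"
  proof (rule no_trade[OF sep H(1) double_exchange[OF M b b'']])
    show "insert e' (B - {b}) \<subseteq> W" "?Y \<subseteq> W" using W fin by auto
    show "card (insert e' (B - {b})) = k" using fin in_B by (metis card_swap)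
    show "card ?Y = k" using fin in_B ne ne' by (metis card_swap2)
    fix x :: "'a \<Rightarrow> real"
    show "sum x (insert e' (B - {b'})) + sum x (insert e (insert e' (B - {b, b''})))
        = sum x (insert e' (B - {b})) + sum x ?Y"
      using sum_swap[of B b' e' x] sum_swap2[of B b e b'' e' x] sum_swap[of B b e' x]
        sum_swap2[of B b' e b'' e' x] in_B fin(1) ne ne' by linarith
  qed
  ultimately show False by blast
qed

text \<open>
  Otherwise \<open>e\<close> and \<open>f\<close> have the same neighbours, by \<open>smaller_is_singleton\<close>, and so are parallel by
  binarity. Then no basis contains both, and \<open>B - b + e\<close> and \<open>B - b - p + f + e'\<close> would
  be traded for the non-bases \<open>B - b + e'\<close> and \<open>B - b - p + e + f\<close>.
\<close>

lemma larger_is_unique: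
  assumes M: "k_matroid k W H" and bin: "binary_matroid W H" and sep: "separable_hypergraph k W H"
    and B: "B \<in> H" and p: "fundamental_edge H B p e'"
    and b: "fundamental_edge H B b e" "\<not> fundamental_edge H B b e'" and c: "fundamental_edge H B c f" "\<not> fundamental_edge H B c e'"
  shows "e = f"
proof (rule ccontr)
  assume ne: "e \<noteq> f"
  have fin: "finite B" "card B = k" "B \<subseteq> W" using k_matroidD[OF M B] by auto
  have in_B: "b \<in> B" "c \<in> B" "p \<in> B" "e \<notin> B" "f \<notin> B" "e' \<notin> B"
    and ne': "b \<noteq> p" "c \<noteq> p" "e \<noteq> e'" "f \<noteq> e'"
    and H: "insert e (B - {b}) \<in> H" "insert e' (B - {p}) \<in> H" "insert f (B - {c}) \<in> H"
    using b c p by (auto simp: fundamental_edge_def)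
  have W: "e \<in> W - B" "f \<in> W - B" "e' \<in> W - B" using k_matroidD(1)[OF M] H in_B by auto
  have pe: "fundamental_edge H B p e" "fundamental_edge H B p f"
    using edge_nested[OF M sep B b W(3) p] edge_nested[OF M sep B c W(3) p] .
  have ef: "fundamental_edge H B d e" if "fundamental_edge H B d f" for d
    using smaller_is_singleton[OF M bin sep B that _ b(1) pe(1)] ne'(1) by blast
  have fe: "fundamental_edge H B d f" if "fundamental_edge H B d e" for d
    using smaller_is_singleton[OF M bin sep B that _ c(1) pe(2)] ne'(2) by blast
  let ?Y = "insert e (insert f (B - {b, p}))"
  have "?Y \<notin> H"
    using ef fe by (intro binary_dependent[OF M bin B W(1,2) ne]) auto
  moreover have "insert e' (B - {b}) \<notin> H" using b in_B by (auto simp: fundamental_edge_def)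
  moreover have "insert e' (B - {b}) \<in> H \<or> ?Y \<in> H"
  proof (rule no_trade[OF sep H(1) double_exchange[OF M fe[OF b(1)] b(2) p]])
    show "insert e' (B - {b}) \<subseteq> W" "?Y \<subseteq> W" using W fin by auto
    show "card (insert e' (B - {b})) = k" using fin in_B by (metis card_swap)
    show "card ?Y = k" using fin in_B ne ne' by (metis card_swap2)
    fix x :: "'a \<Rightarrow> real"
    show "sum x (insert e (B - {b})) + sum x (insert f (insert e' (B - {b, p})))
        = sum x (insert e' (B - {b})) + sum x ?Y"
      using sum_swap[of B b e x] sum_swap2[of B b f p e' x] sum_swap[of B b e' x]
        sum_swap2[of B b e p f x] in_B fin(1) ne ne' by linarith
  qed
  ultimately show False by blast
qed

lemma separable_imp_shape:
  assumes M: "k_matroid k W H" and bin: "binary_matroid W H" and sep: "separable_hypergraph k W H"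
    and B: "B \<in> H"
  shows "complete_edges H B \<or> double_star H B"
proof (cases "complete_edges H B")
  case False
  then obtain b a p q where b: "fundamental_edge H B b a" "\<not> fundamental_edge H B b q" and p: "fundamental_edge H B p q"
    unfolding complete_edges_def by blast
  have inW: "e \<in> W - B" if "fundamental_edge H B d e" for d e
    using that k_matroidD(1)[OF M, of "insert e (B - {d})"] by (auto simp: fundamental_edge_def)
  have "b \<noteq> p" using b p by auto
  have pa: "fundamental_edge H B p a" using edge_nested[OF M sep B b inW[OF p] p] .
  have "d = p \<or> e = a" if de: "fundamental_edge H B d e" for d e
  proof (rule ccontr)
    assume n: "\<not> (d = p \<or> e = a)"
    have dq: "\<not> fundamental_edge H B d q"
      using smaller_is_singleton[OF M bin sep B b p, of d] n by blast
    show False using larger_is_unique[OF M bin sep B p b de dq] n by simp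
  qed
  then show ?thesis using pa unfolding double_star_def by blast
qed simp

section \<open>Each shape gives separating weights\<close>

text \<open>
  The weight of a \<open>k\<close>-set is twice the number of its elements in \<open>C\<close> plus the number of those
  in \<open>A\<close> minus twice the number of loops. It reaches \<open>t = 2|C| + |A| - 1\<close> only for
  sets that contain \<open>C\<close>, avoid the loops and miss at most one element of \<open>A\<close>: each omission in \<open>C\<close>
  and each loop costs 2, and \<open>A\<close> cannot make up for it. As all sets considered have
  \<open>k\<close> elements, subtracting \<open>t / k\<close> from every weight moves the threshold to 0.
\<close>

lemma separable_by_parts:
  fixes W :: "'a set"
  assumes M: "k_matroid k W H" and k: "k > 0" and disj: "C \<inter> A = {}" and B: "C \<union> A \<in> H"
    and P: "P \<inter> (C \<union> A) = {}"
    and H: "\<And>E. E \<in> H \<Longrightarrow> C \<subseteq> E \<and> E \<subseteq> C \<union> A \<union> P \<and> card (E \<inter> P) \<le> 1"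
    and swap: "\<And>a p. a \<in> A \<Longrightarrow> p \<in> P \<Longrightarrow> insert p ((C \<union> A) - {a}) \<in> H"
    and PW: "P \<subseteq> W"
  shows "separable_hypergraph k W H"
proof -
  have fin: "finite W" "finite C" "finite A" "finite P" "C \<subseteq> W" "A \<subseteq> W"
    using k_matroidD[OF M B] PW by (auto intro: finite_subset)
  have cardk: "k = card C + card A" using k_matroidD(2)[OF M B] fin disj by (simp add: card_Un_disjoint)
  define y :: "'a \<Rightarrow> real"
    where "y v = (if v \<in> C then 2 else if v \<in> A then 1 else if v \<in> P then 0 else - 2)" for v
  define t :: real where "t = 2 * real (card C) + real (card A) - 1"
  have sum_y: "sum y E = 2 * card (E \<inter> C) + card (E \<inter> A) - 2 * real (card (E - C - A - P))"
    if "E \<subseteq> W" for E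
  proof -
    have fE: "finite E" using that fin by (auto intro: finite_subset)
    have "y v = 2 * of_bool (v \<in> C) + of_bool (v \<in> A) - 2 * of_bool (v \<notin> C \<and> v \<notin> A \<and> v \<notin> P)" for v
      using disj P by (auto simp: y_def)
    then have "sum y E = (\<Sum>v\<in>E. 2 * of_bool (v \<in> C) + of_bool (v \<in> A)
        - 2 * of_bool (v \<notin> C \<and> v \<notin> A \<and> v \<notin> P))"
      by simp
    also have "\<dots> = 2 * (\<Sum>v\<in>E. of_bool (v \<in> C)) + (\<Sum>v\<in>E. of_bool (v \<in> A))
        - 2 * (\<Sum>v\<in>E. of_bool (v \<notin> C \<and> v \<notin> A \<and> v \<notin> P))"
      by (simp only: sum.distrib sum_subtractf sum_distrib_left)
    also have "\<dots> = 2 * card (E \<inter> C) + card (E \<inter> A)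
        - 2 * real (card (E \<inter> {v. v \<notin> C \<and> v \<notin> A \<and> v \<notin> P}))"
      using fE by (simp add: sum_of_bool_eq)
    also have "E \<inter> {v. v \<notin> C \<and> v \<notin> A \<and> v \<notin> P} = E - C - A - P" by blast
    finally show ?thesis .
  qed
  have parts: "card E = card (E \<inter> C) + card (E \<inter> A) + card (E \<inter> P) + card (E - C - A - P)"
    if "E \<subseteq> W" for E
  proof -
    have fE: "finite E" using that fin by (auto intro: finite_subset)
    have "E = ((E \<inter> C) \<union> (E \<inter> A)) \<union> ((E \<inter> P) \<union> (E - C - A - P))" by blast
    then have "card E = card (((E \<inter> C) \<union> (E \<inter> A)) \<union> ((E \<inter> P) \<union> (E - C - A - P)))" by simp
    also have "\<dots> = card ((E \<inter> C) \<union> (E \<inter> A)) + card ((E \<inter> P) \<union> (E - C - A - P))"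
      using fE P by (intro card_Un_disjoint) auto
    also have "\<dots> = card (E \<inter> C) + card (E \<inter> A) + (card (E \<inter> P) + card (E - C - A - P))"
      using fE disj by (subst (1 2) card_Un_disjoint) auto
    finally show ?thesis by simp
  qed
  have iff: "E \<in> H \<longleftrightarrow> sum y E \<ge> t" if E: "E \<subseteq> W" "card E = k" for E
  proof
    assume "E \<in> H"
    from H[OF this] have *: "E \<inter> C = C" "E - C - A - P = {}" "card (E \<inter> P) \<le> 1" by auto
    have "card A = card (E \<inter> A) + card (E \<inter> P)"
      using parts[OF E(1)] E(2) cardk unfolding *(1,2) by simp
    then show "sum y E \<ge> t" unfolding sum_y[OF E(1)] *(1,2) t_def using *(3) by simp
  next
    assume "sum y E \<ge> t"
    then have ineq: "2 * card (E \<inter> C) + card (E \<inter> A) + 1 \<ge> 2 * card C + card A + 2 * card (E - C - A - P)"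
      unfolding sum_y[OF E(1)] t_def by linarith
    have le: "card (E \<inter> C) \<le> card C" "card (E \<inter> A) \<le> card A" using fin by (auto intro: card_mono)
    have "card (E \<inter> C) = card C" "card (E - C - A - P) = 0" using ineq le by linarith+
    then have CE: "C \<subseteq> E" and E_sub: "E \<subseteq> C \<union> A \<union> P"
      using card_subset_eq[of C "E \<inter> C"] fin finite_subset[OF E(1)] by auto
    show "E \<in> H"
    proof (cases "A \<subseteq> E")
      case True
      then have "C \<union> A \<subseteq> E" using CE by blast
      then have "C \<union> A = E"
        using E fin k_matroidD(2)[OF M B] by (intro card_subset_eq) (auto intro: finite_subset)
      with B show ?thesis by simp
    next
      case False
      then obtain a where a: "a \<in> A" "a \<notin> E" by blast
      have "card (E \<inter> A) < card A" using a fin by (intro psubset_card_mono) auto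
      then have lt: "card (E \<inter> A) = card A - 1" "card (E \<inter> P) \<ge> 1"
        using parts[OF E(1)] E(2) cardk ineq \<open>card (E \<inter> C) = card C\<close> \<open>card (E - C - A - P) = 0\<close>
        by linarith+
      from lt(2) have "E \<inter> P \<noteq> {}" by (metis card.empty not_one_le_zero)
      then obtain p where p: "p \<in> E" "p \<in> P" by blast
      have EA: "E \<inter> A = A - {a}"
        using a fin lt(1) by (intro card_subset_eq) (auto simp: card_Diff_singleton)
      have "insert p ((C \<union> A) - {a}) \<subseteq> E" using p CE EA by blast
      moreover have "card (insert p ((C \<union> A) - {a})) = k" using k_matroidD(2)[OF M swap[OF a(1) p(2)]] .
      ultimately have "insert p ((C \<union> A) - {a}) = E"
        using E fin by (intro card_subset_eq) (auto intro: finite_subset)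
      then show ?thesis using swap[OF a(1) p(2)] by simp
    qed
  qed
  show ?thesis unfolding separable_hypergraph_def
  proof (intro exI[of _ "\<lambda>v. y v - t / k"] set_eqI)
    fix E
    have shift: "(\<Sum>v\<in>E. y v - t / k) = sum y E - t" if "card E = k"
      using that k by (simp add: sum_subtractf)
    show "E \<in> H \<longleftrightarrow> E \<in> {E. E \<subseteq> W \<and> card E = k \<and> 0 \<le> (\<Sum>v\<in>E. y v - t / k)}"
    proof (cases "E \<subseteq> W \<and> card E = k")
      case True
      then show ?thesis using iff[of E] shift by simp
    next
      case False
      then show ?thesis using k_matroidD[OF M, of E] by auto
    qed
  qed
qed

lemma coloop:
  assumes M: "k_matroid k W H" and B: "B \<in> H" and c: "c \<in> B" "\<And>e. \<not> fundamental_edge H B c e" and E: "E \<in> H"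
  shows "c \<in> E"
proof (rule ccontr)
  assume "c \<notin> E"
  then obtain u where "u \<in> E - B" "insert u (B - {c}) \<in> H"
    using basis_exchange[OF M B E, of c] c(1) by auto
  then show False using c by (auto simp: fundamental_edge_def)
qed

lemma no_loop:
  assumes M: "k_matroid k W H" and B: "B \<in> H" and E: "E \<in> H" and e: "e \<in> E - B"
  obtains b where "fundamental_edge H B b e"
proof -
  have "indep_set H (insert e {})" using E e by (auto simp: indep_set_def)
  from exchange_keeping[OF M B _ _ this] e obtain b where "b \<in> B" "insert e (B - {b}) \<in> H" by auto
  with that e show thesis by (auto simp: fundamental_edge_def)
qed

lemma parallel_swap:
  assumes M: "k_matroid k W H" and E: "E \<in> H" "p \<in> E" and q: "indep_set H {q}" and ne: "p \<noteq> q"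
    and par: "\<not> indep_set H {p, q}"
  shows "insert q (E - {p}) \<in> H"
proof -
  have "q \<notin> E" using par E by (auto simp: indep_set_def)
  then obtain b where b: "b \<in> E" "insert q (E - {b}) \<in> H"
    using exchange_keeping[OF M E(1), of "{}" q] q by auto
  have "b = p"
  proof (rule ccontr)
    assume "b \<noteq> p"
    then have "{p, q} \<subseteq> insert q (E - {b})" using E by auto
    then show False using par b by (auto simp: indep_set_def)
  qed
  with b show ?thesis by simp
qed

lemma at_most_one:
  assumes "\<And>u v. u \<in> S \<Longrightarrow> v \<in> S \<Longrightarrow> u = v"
  shows "card S \<le> 1"
  using assms by (metis card_le_Suc0_iff_eq card.infinite One_nat_def le0)

text \<open>
  Take for \<open>A\<close> and \<open>P\<close> the non-isolated vertices inside and outside \<open>B\<close>. All elements of \<open>P\<close>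
  have the neighbourhood \<open>A\<close>, so binarity makes them parallel. (The uniform matroid of rank 2
  on 4 elements shows that this does not follow from the graph alone.)
\<close>

lemma complete_imp_separable:
  assumes M: "k_matroid k W H" and bin: "binary_matroid W H" and k: "k > 0"
    and B: "B \<in> H" and comp: "complete_edges H B"
  shows "separable_hypergraph k W H"
proof -
  define A where "A = {b. \<exists>e. fundamental_edge H B b e}"
  define P where "P = {e. \<exists>b. fundamental_edge H B b e}"
  have AB: "A \<subseteq> B" and PB: "P \<inter> B = {}" by (auto simp: A_def P_def fundamental_edge_def)
  have CA: "(B - A) \<union> A = B" using AB by blast
  have full: "fundamental_edge H B a p" if "a \<in> A" "p \<in> P" for a p
    using that comp unfolding A_def P_def complete_edges_def by blast
  have PW: "P \<subseteq> W" using k_matroidD(1)[OF M] by (fastforce simp: P_def fundamental_edge_def)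
  have par: "u = v" if E: "E \<in> H" and uv: "u \<in> E \<inter> P" "v \<in> E \<inter> P" for E u v
  proof (rule ccontr)
    assume ne: "u \<noteq> v"
    have "E \<notin> H"
    proof (rule binary_dependent[OF M bin B _ _ ne])
      show "fundamental_edge H B b u" if "fundamental_edge H B b v" for b using that full uv by (auto simp: A_def)
      show "b \<in> E" if "fundamental_edge H B b u" "\<not> fundamental_edge H B b v" for b using that full uv by (auto simp: A_def)
    qed (use uv PW PB in auto)
    with E show False by simp
  qed
  show ?thesis
  proof (rule separable_by_parts[OF M k, of "B - A" A P])
    show "B - A \<subseteq> E \<and> E \<subseteq> B - A \<union> A \<union> P \<and> card (E \<inter> P) \<le> 1" if E: "E \<in> H" for E
    proof (intro conjI)
      show "B - A \<subseteq> E" using coloop[OF M B _ _ E] by (auto simp: A_def)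
      have "e \<in> P" if "e \<in> E" "e \<notin> B" for e
      proof -
        from that obtain b where "fundamental_edge H B b e" using no_loop[OF M B E, of e] by auto
        then show ?thesis by (auto simp: P_def)
      qed
      then show "E \<subseteq> B - A \<union> A \<union> P" using CA by auto
      show "card (E \<inter> P) \<le> 1" using par[OF E] by (intro at_most_one) auto
    qed
    show "insert p (B - A \<union> A - {a}) \<in> H" if "a \<in> A" "p \<in> P" for a p
      using full[OF that] unfolding CA by (auto simp: fundamental_edge_def)
  qed (use B CA PB PW in auto)
qed

text \<open>
  Let \<open>pa\<close> be the central edge. After exchanging \<open>p\<close> for \<open>a\<close> the double star becomes
  complete bipartite: the basis \<open>B - p + a\<close> is \<open>C \<union> A\<close>, and \<open>P\<close> consists of \<open>p\<close> and of the leaves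
  attached to \<open>p\<close> other than \<open>a\<close>. Such a leaf is parallel to \<open>p\<close> because \<open>p\<close> is its only neighbour.
\<close>

lemma double_star_imp_separable:
  assumes M: "k_matroid k W H" and k: "k > 0" and B: "B \<in> H" and star: "double_star H B"
  shows "separable_hypergraph k W H"
proof -
  from star obtain p a where pa: "fundamental_edge H B p a"
    and all: "\<And>b e. fundamental_edge H B b e \<Longrightarrow> b = p \<or> e = a" unfolding double_star_def by blast
  define A where "A = insert a ({b. fundamental_edge H B b a} - {p})"
  define P where "P = insert p ({e. fundamental_edge H B p e} - {a})"
  define C where "C = B - {b. fundamental_edge H B b a}"
  have in_B: "p \<in> B" "a \<notin> B" using pa by (auto simp: fundamental_edge_def)
  have CA: "C \<union> A = insert a (B - {p})"
    using pa unfolding C_def A_def by (auto simp: fundamental_edge_def)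
  have PW: "P \<subseteq> W" using k_matroidD(1)[OF M] B in_B by (fastforce simp: P_def fundamental_edge_def)
  have nonloop: "indep_set H {q}" if "q \<in> P" for q
    using that B in_B by (auto simp: indep_set_def P_def fundamental_edge_def)
  have par: "\<not> indep_set H {p, q}" if q: "q \<in> P" "q \<noteq> p" for q
  proof
    assume "indep_set H {p, q}"
    then have ind: "indep_set H (insert q {p})" by (simp add: insert_commute)
    have "q \<notin> B" "q \<noteq> a" using q by (auto simp: P_def fundamental_edge_def)
    with exchange_keeping[OF M B _ _ ind] in_B obtain b
      where "b \<in> B - {p}" "insert q (B - {b}) \<in> H" by auto
    then show False using all[of b q] \<open>q \<notin> B\<close> \<open>q \<noteq> a\<close> by (auto simp: fundamental_edge_def)
  qed
  have par2: "u = v" if E: "E \<in> H" and uv: "u \<in> E \<inter> P" "v \<in> E \<inter> P" for E u v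
  proof (rule ccontr)
    assume ne: "u \<noteq> v"
    have up: "u \<noteq> p" "v \<noteq> p" using par E uv ne by (auto simp: indep_set_def)
    have "\<not> indep_set H {u, p}" using par[of u] uv up by (simp add: insert_commute)
    then have "insert p (E - {u}) \<in> H"
      using parallel_swap[OF M E] uv up nonloop[of p] by (auto simp: P_def)
    moreover have "{p, v} \<subseteq> insert p (E - {u})" using uv ne by auto
    ultimately have "indep_set H {p, v}" unfolding indep_set_def by (intro bexI)
    then show False using par[of v] uv up by simp
  qed
  show ?thesis
  proof (rule separable_by_parts[OF M k, of C A P])
    show "C \<inter> A = {}" using in_B by (auto simp: C_def A_def)
    show "C \<union> A \<in> H" using pa unfolding CA by (simp add: fundamental_edge_def)
    show "P \<inter> (C \<union> A) = {}" unfolding CA using in_B by (auto simp: P_def fundamental_edge_def)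
    show "P \<subseteq> W" by (rule PW)
    show "C \<subseteq> E \<and> E \<subseteq> C \<union> A \<union> P \<and> card (E \<inter> P) \<le> 1" if E: "E \<in> H" for E
    proof (intro conjI)
      show "C \<subseteq> E"
      proof
        fix c assume "c \<in> C"
        then have "c \<in> B" "\<not> fundamental_edge H B c e" for e using all[of c e] pa by (auto simp: C_def)
        then show "c \<in> E" using coloop[OF M B _ _ E] by blast
      qed
      show "E \<subseteq> C \<union> A \<union> P"
      proof
        fix e assume e: "e \<in> E"
        show "e \<in> C \<union> A \<union> P"
        proof (cases "e \<in> B")
          case False
          then obtain b where "fundamental_edge H B b e" using no_loop[OF M B E, of e] e by auto
          then show ?thesis using all[of b e] by (auto simp: A_def P_def)
        qed (auto simp: CA P_def)
      qed
      show "card (E \<inter> P) \<le> 1" using par2[OF E] by (intro at_most_one) auto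
    qed
    show "insert q (C \<union> A - {a'}) \<in> H" if a': "a' \<in> A" and q: "q \<in> P" for a' q
    proof -
      have base: "insert p (C \<union> A - {a'}) \<in> H"
      proof (cases "a' = a")
        case True
        then have "insert p (C \<union> A - {a'}) = B" unfolding CA using in_B by auto
        then show ?thesis using B by simp
      next
        case False
        then have "fundamental_edge H B a' a" "a' \<noteq> p" using a' by (auto simp: A_def)
        moreover have "insert p (C \<union> A - {a'}) = insert a (B - {a'})"
          unfolding CA using in_B False \<open>a' \<noteq> p\<close> by auto
        ultimately show ?thesis by (simp add: fundamental_edge_def)
      qed
      show ?thesis
      proof (cases "q = p")
        case False
        have "insert q (insert p (C \<union> A - {a'}) - {p}) \<in> H"
          using False by (intro parallel_swap[OF M base insertI1 nonloop[OF q] _ par[OF q False]]) simp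
        moreover have "p \<notin> C \<union> A" unfolding CA using in_B by auto
        ultimately show ?thesis by simp
      qed (use base in simp)
    qed
  qed
qed

lemma separable_iff_shape:
  assumes "k_matroid k W H" "binary_matroid W H" "k > 0" "B \<in> H"
  shows "separable_hypergraph k W H \<longleftrightarrow> complete_edges H B \<or> double_star H B"
  using separable_imp_shape complete_imp_separable double_star_imp_separable assms by metis

section \<open>Total correctness with a step bound\<close>

definition halts :: "(nat set \<Rightarrow> bool) \<Rightarrow> com \<Rightarrow> state \<Rightarrow> nat \<Rightarrow> (state \<Rightarrow> bool) \<Rightarrow> bool" where
  "halts orc c s T Q \<longleftrightarrow> (\<exists>t q s'. exec orc c s t q s' \<and> t \<le> T \<and> Q s')"

lemma queries_le_steps: "exec orc c s t q s' \<Longrightarrow> q \<le> t"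
  by (induction rule: exec.induct) auto

lemma halts_Skip: "Q s \<Longrightarrow> 1 \<le> T \<Longrightarrow> halts orc Skip s T Q"
  unfolding halts_def using exec.Skip by blast

lemma halts_Const: "Q (r(d := c), m) \<Longrightarrow> 1 \<le> T \<Longrightarrow> halts orc (Const d c) (r, m) T Q"
  unfolding halts_def using exec.Const by blast

lemma halts_Move: "Q (r(d := r a), m) \<Longrightarrow> 1 \<le> T \<Longrightarrow> halts orc (Move d a) (r, m) T Q"
  unfolding halts_def using exec.Move by blast

lemma halts_Add: "Q (r(d := r a + r b), m) \<Longrightarrow> 1 \<le> T \<Longrightarrow> halts orc (Add d a b) (r, m) T Q"
  unfolding halts_def using exec.Add by blast

lemma halts_Sub: "Q (r(d := r a - r b), m) \<Longrightarrow> 1 \<le> T \<Longrightarrow> halts orc (Sub d a b) (r, m) T Q"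
  unfolding halts_def using exec.Sub by blast

lemma halts_Load: "Q (r(d := m (r a)), m) \<Longrightarrow> 1 \<le> T \<Longrightarrow> halts orc (Load d a) (r, m) T Q"
  unfolding halts_def using exec.Load by blast

lemma halts_Store: "Q (r, m(r a := r b)) \<Longrightarrow> 1 \<le> T \<Longrightarrow> halts orc (Store a b) (r, m) T Q"
  unfolding halts_def using exec.Store by blast

lemma halts_Query:
  "Q (r(d := (if orc {i. m (r a + i) \<noteq> 0} then 1 else 0)), m) \<Longrightarrow> 1 \<le> T
    \<Longrightarrow> halts orc (Query d a) (r, m) T Q"
  unfolding halts_def using exec.Query by blast

lemma halts_Seq:
  assumes "halts orc c1 s T1 R" "\<And>s'. R s' \<Longrightarrow> halts orc c2 s' T2 Q" "T1 + T2 \<le> T"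
  shows "halts orc (Seq c1 c2) s T Q"
proof -
  from assms(1) obtain t1 q1 s1 where 1: "exec orc c1 s t1 q1 s1" "t1 \<le> T1" "R s1"
    unfolding halts_def by blast
  from assms(2)[OF 1(3)] obtain t2 q2 s2 where 2: "exec orc c2 s1 t2 q2 s2" "t2 \<le> T2" "Q s2"
    unfolding halts_def by blast
  have "t1 + t2 \<le> T" using 1 2 assms(3) by linarith
  with exec.Seq[OF 1(1) 2(1)] 2(3) show ?thesis unfolding halts_def by blast
qed

lemma halts_step:
  assumes "halts orc c1 s 1 (\<lambda>s'. halts orc c2 s' T Q)"
  shows "halts orc (Seq c1 c2) s (Suc T) Q"
  using assms by (rule halts_Seq) auto

lemma halts_Cond:
  assumes "r b \<noteq> 0 \<Longrightarrow> halts orc c1 (r, m) T Q" "r b = 0 \<Longrightarrow> halts orc c2 (r, m) T Q"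
  shows "halts orc (Cond b c1 c2) (r, m) (Suc T) Q"
proof (cases "r b = 0")
  case True
  from assms(2)[OF True] obtain t q s' where *: "exec orc c2 (r, m) t q s'" "t \<le> T" "Q s'"
    unfolding halts_def by blast
  have "exec orc (Cond b c1 c2) (r, m) (1 + t) q s'" using True * by (intro exec.CondFalse) auto
  with * show ?thesis unfolding halts_def by (intro exI conjI) auto
next
  case False
  from assms(1)[OF False] obtain t q s' where *: "exec orc c1 (r, m) t q s'" "t \<le> T" "Q s'"
    unfolding halts_def by blast
  have "exec orc (Cond b c1 c2) (r, m) (1 + t) q s'" using False * by (intro exec.CondTrue) auto
  with * show ?thesis unfolding halts_def by (intro exI conjI) auto
qed

lemma halts_weaken: "halts orc c s T Q \<Longrightarrow> T \<le> T' \<Longrightarrow> (\<And>s. Q s \<Longrightarrow> Q' s) \<Longrightarrow> halts orc c s T' Q'"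
  unfolding halts_def by (meson le_trans)

lemma halts_While_step:
  assumes "fst s b \<noteq> 0" "halts orc c s T1 (\<lambda>s'. halts orc (While b c) s' T2 Q)"
  shows "halts orc (While b c) s (Suc (T1 + T2)) Q"
proof -
  from assms(2) obtain t1 q1 s1 t2 q2 s2 where
    1: "exec orc c s t1 q1 s1" "t1 \<le> T1" and 2: "exec orc (While b c) s1 t2 q2 s2" "t2 \<le> T2" "Q s2"
    unfolding halts_def by blast
  show ?thesis unfolding halts_def
    using exec.WhileTrue[of s b, OF assms(1) 1(1) 2(1)] 1(2) 2(2,3) by (intro exI conjI) auto
qed

lemma halts_While_stop: "fst s b = 0 \<Longrightarrow> Q s \<Longrightarrow> 1 \<le> T \<Longrightarrow> halts orc (While b c) s T Q"
  unfolding halts_def using exec.WhileFalse by blast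

text \<open>
  Register 0 holds the number \<open>n\<close> of rounds and register 2 the constant 1. The guard register \<open>g\<close>
  holds the number \<open>n - v\<close> of rounds left, since a test can only ask whether a register is zero.
\<close>

definition for_loop :: "nat \<Rightarrow> nat \<Rightarrow> com \<Rightarrow> com" where
  "for_loop v g c = Seq (Const v 0) (Seq (Sub g 0 v)
     (While g (Seq c (Seq (Add v v 2) (Sub g 0 v)))))"

text \<open>
  Each round spends 3 steps besides the body: the test, the increment and the new guard. The invariant
  \<open>I i\<close> describes the state after \<open>i\<close> rounds; stability says that it does not
  depend on the counter and the guard.
\<close>

lemma halts_for_loop:
  assumes regs: "2 < v" "2 < g" "v \<noteq> g"
    and stable: "\<And>i r m x y. I i r m \<Longrightarrow> I i (r(v := x, g := y)) m"
    and body: "\<And>i r m. i < n \<Longrightarrow> I i r m \<Longrightarrow> r v = i \<Longrightarrow> r 0 = n \<Longrightarrow> r 2 = 1 \<Longrightarrow>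
       halts orc c (r, m) T (\<lambda>(r', m'). I (Suc i) r' m' \<and> r' v = i \<and> r' 0 = n \<and> r' 2 = 1)"
    and init: "I 0 r m" "r 0 = n" "r 2 = 1"
  shows "halts orc (for_loop v g c) (r, m) (n * (T + 3) + 3) (\<lambda>(r', m'). I n r' m' \<and> r' 0 = n \<and> r' 2 = 1)"
proof -
  define Q where "Q = (\<lambda>(r', m'). I n r' m' \<and> r' 0 = n \<and> r' (2::nat) = (1::nat))"
  let ?w = "While g (Seq c (Seq (Add v v 2) (Sub g 0 v)))"
  have loop: "halts orc ?w (r, m) (k * (T + 3) + 1) Q"
    if "k = n - i" "i \<le> n" "I i r m" "r v = i" "r g = n - i" "r 0 = n" "r 2 = 1" for k i r m
    using that
  proof (induction k arbitrary: i r m)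
    case 0
    then show ?case by (auto simp: Q_def intro!: halts_While_stop)
  next
    case (Suc k)
    have "halts orc ?w (r, m) (Suc ((T + 2) + (k * (T + 3) + 1))) Q"
    proof (rule halts_While_step)
      show "halts orc (Seq c (Seq (Add v v 2) (Sub g 0 v))) (r, m) (T + 2)
              (\<lambda>s'. halts orc ?w s' (k * (T + 3) + 1) Q)"
      proof (rule halts_Seq[OF body])
        fix s' assume "case s' of (r', m') \<Rightarrow> I (Suc i) r' m' \<and> r' v = i \<and> r' 0 = n \<and> r' 2 = 1"
        then obtain r' m' where s': "s' = (r', m')" "I (Suc i) r' m'" "r' v = i" "r' 0 = n" "r' 2 = 1"
          by (cases s') auto
        have "halts orc ?w (r'(v := Suc i, g := n - Suc i), m') (k * (T + 3) + 1) Q"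
          using Suc.prems(1,2) s' regs
          by (intro Suc.IH[OF _ _ stable[OF s'(2)]]) auto
        then have "halts orc (Seq (Add v v 2) (Sub g 0 v)) s' (Suc 1)
               (\<lambda>s'. halts orc ?w s' (k * (T + 3) + 1) Q)"
          unfolding s'(1) using s' regs
          by (intro halts_step halts_Add halts_Sub) auto
        then show "halts orc (Seq (Add v v 2) (Sub g 0 v)) s' 2
               (\<lambda>s'. halts orc ?w s' (k * (T + 3) + 1) Q)"
          by (simp add: numeral_2_eq_2)
      qed (use Suc.prems in auto)
    qed (use Suc.prems in auto)
    then show ?case by (rule halts_weaken) auto
  qed
  have "halts orc ?w (r(v := 0, g := n), m) (n * (T + 3) + 1) Q"
    using regs init by (intro loop[OF _ _ stable[OF init(1)]]) auto
  then have "halts orc (for_loop v g c) (r, m) (Suc (Suc (n * (T + 3) + 1))) Q"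
    unfolding for_loop_def using init regs by (intro halts_step halts_Const halts_Sub) auto
  then show ?thesis unfolding Q_def by (rule halts_weaken) auto
qed

section \<open>First-order formulas evaluated by programs\<close>

text \<open>
  Variables are de Bruijn levels: the quantifier below \<open>l\<close> others binds variable \<open>l\<close>. They range
  over \<open>{..<n}\<close>. For a set \<open>S\<close> held in memory, \<open>Mem x\<close> tests membership in \<open>S\<close>
  and \<open>Exch x y\<close> asks the oracle for \<open>S\<close> with \<open>x\<close> removed and then \<open>y\<close> added.
\<close>

datatype formula =
    Mem nat
  | Exch nat nat
  | Equal nat nat
  | Neg formula
  | Conj formula formula
  | Exists formula

fun closed_below :: "nat \<Rightarrow> formula \<Rightarrow> bool" where
  "closed_below l (Mem x) \<longleftrightarrow> x < l"
| "closed_below l (Exch x y) \<longleftrightarrow> x < l \<and> y < l"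
| "closed_below l (Equal x y) \<longleftrightarrow> x < l \<and> y < l"
| "closed_below l (Neg f) \<longleftrightarrow> closed_below l f"
| "closed_below l (Conj f g) \<longleftrightarrow> closed_below l f \<and> closed_below l g"
| "closed_below l (Exists f) \<longleftrightarrow> closed_below (Suc l) f"

fun holds :: "(nat set \<Rightarrow> bool) \<Rightarrow> nat \<Rightarrow> nat set \<Rightarrow> nat \<Rightarrow> formula \<Rightarrow> (nat \<Rightarrow> nat) \<Rightarrow> bool" where
  "holds orc n S l (Mem x) e \<longleftrightarrow> e x \<in> S"
| "holds orc n S l (Exch x y) e \<longleftrightarrow> orc (insert (e y) (S - {e x}))"
| "holds orc n S l (Equal x y) e \<longleftrightarrow> e x = e y"
| "holds orc n S l (Neg f) e \<longleftrightarrow> \<not> holds orc n S l f e"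
| "holds orc n S l (Conj f g) e \<longleftrightarrow> holds orc n S l f e \<and> holds orc n S l g e"
| "holds orc n S l (Exists f) e \<longleftrightarrow> (\<exists>i<n. holds orc n S (Suc l) f (e(l := i)))"

text \<open>
  Level \<open>l\<close> owns three registers above those of all lower levels, so that evaluating a subformula
  at level \<open>l\<close> cannot disturb the variables bound outside it. Registers 0, 1 and 2 hold \<open>n\<close>, 0
  and 1.
\<close>

definition result_reg :: "nat \<Rightarrow> nat" where "result_reg l = 3 * l + 3"
definition var_reg :: "nat \<Rightarrow> nat" where "var_reg l = 3 * l + 4"
definition aux_reg :: "nat \<Rightarrow> nat" where "aux_reg l = 3 * l + 5"

text \<open>
  A query reads the characteristic vector from memory, so \<open>Exch\<close> overwrites two entries of it, asks, and
  restores them in the reverse order; the order matters when the two entries coincide. For an atom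
  the variable register of its own level is not bound yet and serves as scratch space.
\<close>

fun compile :: "nat \<Rightarrow> formula \<Rightarrow> com" where
  "compile l (Mem x) =
     Seq (Load (result_reg l) (var_reg x)) (Cond (result_reg l) (Const (result_reg l) 1) Skip)"
| "compile l (Exch x y) =
     Seq (Load (var_reg l) (var_reg x)) (Seq (Store (var_reg x) 1)
     (Seq (Load (aux_reg l) (var_reg y)) (Seq (Store (var_reg y) 2)
     (Seq (Query (result_reg l) 1)
     (Seq (Store (var_reg y) (aux_reg l)) (Store (var_reg x) (var_reg l)))))))"
| "compile l (Equal x y) =
     Seq (Sub (result_reg l) (var_reg x) (var_reg y)) (Seq (Sub (var_reg l) (var_reg y) (var_reg x))
     (Seq (Add (result_reg l) (result_reg l) (var_reg l)) (Cond (result_reg l) (Const (result_reg l) 0) (Const (result_reg l) 1))))"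
| "compile l (Neg f) = Seq (compile l f) (Sub (result_reg l) 2 (result_reg l))"
| "compile l (Conj f g) = Seq (compile l f) (Cond (result_reg l) (compile l g) Skip)"
| "compile l (Exists f) =
     Seq (Const (result_reg l) 0) (for_loop (var_reg l) (aux_reg l)
       (Seq (compile (Suc l) f) (Cond (result_reg (Suc l)) (Const (result_reg l) 1) Skip)))"

fun cost :: "formula \<Rightarrow> nat poly" where
  "cost (Mem x) = [:3:]"
| "cost (Exch x y) = [:7:]"
| "cost (Equal x y) = [:5:]"
| "cost (Neg f) = cost f + [:1:]"
| "cost (Conj f g) = cost f + cost g + [:2:]"
| "cost (Exists f) = [:0, 1:] * (cost f + [:5:]) + [:4:]"

definition evaluated :: "nat \<Rightarrow> (nat \<Rightarrow> nat) \<Rightarrow> (nat \<Rightarrow> nat) \<Rightarrow> bool \<Rightarrow> state \<Rightarrow> bool" where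
  "evaluated l r m b s \<longleftrightarrow>
     snd s = m \<and> (\<forall>j<result_reg l. fst s j = r j) \<and> fst s (result_reg l) = (if b then 1 else 0)"

text \<open>
  Level \<open>l\<close> needs a single result register: the second conjunct is evaluated only if the first one
  holds, and then its result is that of the conjunction; a quantifier evaluates its body at
  level \<open>l + 1\<close>.
\<close>

lemma halts_compile:
  assumes "closed_below l f" "r 0 = n" "r 1 = 0" "r 2 = 1" "\<And>x. x < l \<Longrightarrow> r (var_reg x) = e x"
  shows "halts orc (compile l f) (r, m) (poly (cost f) n)
           (evaluated l r m (holds orc n {i. m i \<noteq> 0} l f e))"
  using assms
proof (induction f arbitrary: l r e)
  case (Mem x)
  then have "halts orc (compile l (Mem x)) (r, m) (Suc (Suc 1))
           (evaluated l r m (holds orc n {i. m i \<noteq> 0} l (Mem x) e))"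
    unfolding compile.simps
    by (intro halts_step halts_Load halts_Cond halts_Const halts_Skip) (auto simp: evaluated_def)
  then show ?case by (simp add: numeral_3_eq_3)
next
  case (Exch x y)
  have regs: "var_reg x < result_reg l" "var_reg y < result_reg l" "result_reg l \<noteq> var_reg l" "result_reg l \<noteq> aux_reg l" "var_reg l \<noteq> aux_reg l"
    "1 < result_reg l" "2 < result_reg l" "\<And>j. j < result_reg l \<Longrightarrow> j \<noteq> var_reg l" "\<And>j. j < result_reg l \<Longrightarrow> j \<noteq> aux_reg l"
    using Exch by (auto simp: result_reg_def var_reg_def aux_reg_def)
  have query_set: "{i. (m(e x := 0, e y := 1)) i \<noteq> 0} = insert (e y) ({i. m i \<noteq> 0} - {e x})"
    by auto
  have "halts orc (compile l (Exch x y)) (r, m) (Suc (Suc (Suc (Suc (Suc (Suc 1))))))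
           (evaluated l r m (holds orc n {i. m i \<noteq> 0} l (Exch x y) e))"
    unfolding compile.simps
    apply (intro halts_step halts_Load halts_Store halts_Query order_refl)
    using Exch regs query_set by (auto simp: evaluated_def)
  then show ?case by (simp add: eval_nat_numeral)
next
  case (Equal x y)
  have regs: "var_reg x < result_reg l" "var_reg y < result_reg l" "result_reg l < var_reg l" using Equal by (auto simp: result_reg_def var_reg_def)
  have "halts orc (compile l (Equal x y)) (r, m) (Suc (Suc (Suc (Suc 1))))
           (evaluated l r m (holds orc n {i. m i \<noteq> 0} l (Equal x y) e))"
    unfolding compile.simps
    apply (intro halts_step halts_Sub halts_Add halts_Cond halts_Const order_refl)
    using Equal regs by (auto simp: evaluated_def)
  then show ?case by (simp add: eval_nat_numeral)
next
  case (Neg f)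
  have "halts orc (compile l (Neg f)) (r, m) (poly (cost f) n + 1)
           (evaluated l r m (holds orc n {i. m i \<noteq> 0} l (Neg f) e))"
    unfolding compile.simps
  proof (rule halts_Seq)
    show "halts orc (compile l f) (r, m) (poly (cost f) n)
           (evaluated l r m (holds orc n {i. m i \<noteq> 0} l f e))" using Neg by auto
    fix s assume s: "evaluated l r m (holds orc n {i. m i \<noteq> 0} l f e) s"
    obtain r' m' where "s = (r', m')" by (cases s)
    then show "halts orc (Sub (result_reg l) 2 (result_reg l)) s 1 (evaluated l r m (holds orc n {i. m i \<noteq> 0} l (Neg f) e))"
      using s Neg.prems by (auto simp: evaluated_def result_reg_def intro!: halts_Sub)
  qed simp
  then show ?case by simp
next
  case (Conj f g)
  have "halts orc (compile l (Conj f g)) (r, m) (poly (cost f) n + Suc (poly (cost g) n + 1))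
           (evaluated l r m (holds orc n {i. m i \<noteq> 0} l (Conj f g) e))"
    unfolding compile.simps
  proof (rule halts_Seq)
    show "halts orc (compile l f) (r, m) (poly (cost f) n)
           (evaluated l r m (holds orc n {i. m i \<noteq> 0} l f e))" using Conj by auto
    fix s assume s: "evaluated l r m (holds orc n {i. m i \<noteq> 0} l f e) s"
    obtain r' where r': "s = (r', m)" "\<forall>j<result_reg l. r' j = r j"
      "r' (result_reg l) = (if holds orc n {i. m i \<noteq> 0} l f e then 1 else 0)"
      using s by (cases s) (auto simp: evaluated_def)
    have "\<And>x. x < l \<Longrightarrow> r' (var_reg x) = e x" "r' 0 = n" "r' 1 = 0" "r' 2 = 1"
      using r'(2) Conj.prems by (auto simp: result_reg_def var_reg_def)
    then have g: "halts orc (compile l g) (r', m) (poly (cost g) n)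
           (evaluated l r' m (holds orc n {i. m i \<noteq> 0} l g e))" using Conj by auto
    show "halts orc (Cond (result_reg l) (compile l g) Skip) s (Suc (poly (cost g) n + 1))
       (evaluated l r m (holds orc n {i. m i \<noteq> 0} l (Conj f g) e))"
      unfolding r'(1)
    proof (rule halts_Cond)
      assume "r' (result_reg l) \<noteq> 0"
      then show "halts orc (compile l g) (r', m) (poly (cost g) n + 1)
         (evaluated l r m (holds orc n {i. m i \<noteq> 0} l (Conj f g) e))"
        using r' by (intro halts_weaken[OF g]) (auto simp: evaluated_def split: if_splits)
    next
      assume "r' (result_reg l) = 0"
      then show "halts orc Skip (r', m) (poly (cost g) n + 1)
         (evaluated l r m (holds orc n {i. m i \<noteq> 0} l (Conj f g) e))"
        using r' by (intro halts_Skip) (auto simp: evaluated_def split: if_splits)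
    qed
  qed simp
  then show ?case by simp
next
  case (Exists f)
  have regs: "2 < var_reg l" "2 < aux_reg l" "var_reg l \<noteq> aux_reg l" "result_reg l < var_reg l" "var_reg l < result_reg (Suc l)"
     "result_reg l < aux_reg l" "2 < result_reg l" "result_reg l < result_reg (Suc l)" "var_reg l < aux_reg l"
    by (auto simp: result_reg_def var_reg_def aux_reg_def)
  define I where "I i r' m' \<longleftrightarrow>
    evaluated l r m (\<exists>i'<i. holds orc n {i. m i \<noteq> 0} (Suc l) f (e(l := i'))) (r', m')" for i r' m'
  let ?b = "Seq (compile (Suc l) f) (Cond (result_reg (Suc l)) (Const (result_reg l) 1) Skip)"
  have body: "halts orc ?b (r', m') (poly (cost f) n + 2)
       (\<lambda>(r', m'). I (Suc i) r' m' \<and> r' (var_reg l) = i \<and> r' 0 = n \<and> r' 2 = 1)"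
    if i: "i < n" "I i r' m'" "r' (var_reg l) = i" "r' 0 = n" "r' 2 = 1" for i r' m'
  proof (rule halts_Seq)
    let ?h = "holds orc n {i. m i \<noteq> 0} (Suc l) f (e(l := i))"
    have m': "m' = m" and r': "\<forall>j<result_reg l. r' j = r j" using i by (auto simp: I_def evaluated_def)
    have "r' (var_reg x) = (e(l := i)) x" if "x < Suc l" for x
      using r' Exists.prems(5) i(3) that by (auto simp: result_reg_def var_reg_def less_Suc_eq)
    moreover have "r' 1 = 0" using r' Exists.prems(3) by (auto simp: result_reg_def)
    ultimately show "halts orc (compile (Suc l) f) (r', m') (poly (cost f) n) (evaluated (Suc l) r' m ?h)"
      unfolding m' using Exists i by auto
    fix s assume s: "evaluated (Suc l) r' m ?h s"
    obtain r2 where r2: "s = (r2, m)" "\<forall>j<result_reg (Suc l). r2 j = r' j"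
      "r2 (result_reg (Suc l)) = (if ?h then 1 else 0)"
      using s by (cases s) (auto simp: evaluated_def)
    have low: "r2 (var_reg l) = i" "r2 0 = n" "r2 2 = 1" "r2 (result_reg l) = r' (result_reg l)"
      "\<forall>j<result_reg l. r2 j = r j"
      using r2(2) i regs r' by auto
    have "halts orc (Cond (result_reg (Suc l)) (Const (result_reg l) 1) Skip) s (Suc 1)
        (\<lambda>(r', m'). I (Suc i) r' m' \<and> r' (var_reg l) = i \<and> r' 0 = n \<and> r' 2 = 1)"
      unfolding r2(1)
      using r2(3) low regs i(2)
      by (intro halts_Cond halts_Const halts_Skip)
         (auto simp: I_def evaluated_def less_Suc_eq split: if_splits)
    then show "halts orc (Cond (result_reg (Suc l)) (Const (result_reg l) 1) Skip) s 2
        (\<lambda>(r', m'). I (Suc i) r' m' \<and> r' (var_reg l) = i \<and> r' 0 = n \<and> r' 2 = 1)"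
      by (simp only: Suc_1)
  qed simp
  have "halts orc (for_loop (var_reg l) (aux_reg l) ?b) (r(result_reg l := 0), m) (n * (poly (cost f) n + 2 + 3) + 3)
      (\<lambda>(r', m'). I n r' m' \<and> r' 0 = n \<and> r' 2 = 1)"
    using regs Exists.prems
    by (intro halts_for_loop body) (auto simp: I_def evaluated_def)
  then have "halts orc (compile l (Exists f)) (r, m) (Suc (n * (poly (cost f) n + 2 + 3) + 3))
      (\<lambda>(r', m'). I n r' m' \<and> r' 0 = n \<and> r' 2 = 1)"
    unfolding compile.simps by (intro halts_step halts_Const) auto
  then show ?case by (rule halts_weaken) (auto simp: I_def)
qed

section \<open>The decision procedure\<close>

definition greedy :: com where
  "greedy = for_loop 3 4 (Seq (Store 3 2) (Seq (Query 5 1) (Cond 5 Skip (Store 3 1))))"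

text \<open>
  An element rejected at some point stays dependent on the final set, because the latter contains the set
  for which it was rejected and the oracle is antimonotone.
\<close>

lemma halts_greedy:
  assumes anti: "\<And>I J. I \<subseteq> J \<Longrightarrow> orc J \<Longrightarrow> orc I" and emp: "orc {}"
    and init: "r 0 = n" "r 1 = 0" "r 2 = 1"
  shows "halts orc greedy (r, \<lambda>_. 0) (n * 7 + 3) (\<lambda>(r', m'). r' 0 = n \<and> r' 1 = 0 \<and> r' 2 = 1 \<and>
     {i. m' i \<noteq> 0} \<subseteq> {..<n} \<and> orc {i. m' i \<noteq> 0} \<and>
     (\<forall>j<n. j \<notin> {i. m' i \<noteq> 0} \<longrightarrow> \<not> orc (insert j {i. m' i \<noteq> 0})))"
proof -
  define I where "I i r m \<longleftrightarrow> r 1 = 0 \<and> {i. m i \<noteq> 0} \<subseteq> {..<i} \<and> orc {i. m i \<noteq> 0} \<and>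
    (\<forall>j<i. j \<notin> {i. m i \<noteq> 0} \<longrightarrow> \<not> orc (insert j {i. m i \<noteq> 0}))" for i :: nat and r m :: "nat \<Rightarrow> nat"
  have body: "halts orc (Seq (Store 3 2) (Seq (Query 5 1) (Cond 5 Skip (Store 3 1)))) (r, m) (Suc (Suc (Suc 1)))
       (\<lambda>(r', m'). I (Suc i) r' m' \<and> r' 3 = i \<and> r' 0 = n \<and> r' 2 = 1)"
    if i: "i < n" "I i r m" "r 3 = i" "r 0 = n" "r 2 = 1" for i r m
  proof -
    let ?S = "{i. m i \<noteq> 0}"
    have S: "r 1 = 0" "?S \<subseteq> {..<i}" "orc ?S" "\<And>j. j < i \<Longrightarrow> j \<notin> ?S \<Longrightarrow> \<not> orc (insert j ?S)"
      using i(2) unfolding I_def by blast+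
    have mi: "m i = 0" using S(2) by auto
    have new: "{h. (m(i := 1)) h \<noteq> 0} = insert i ?S" by auto
    have old: "{h. (m(i := 1, i := 0)) h \<noteq> 0} = ?S" using mi by auto
    show ?thesis
    proof (cases "orc (insert i ?S)")
      case True
      have "\<not> orc (insert j (insert i ?S))" if "j < Suc i" "j \<notin> insert i ?S" for j
        using anti[of "insert j ?S" "insert j (insert i ?S)"] S(4)[of j] that by auto
      then have "I (Suc i) (r(5 := 1)) (m(i := 1))"
        unfolding I_def new using S True by auto
      then show ?thesis using i S True new
        by (intro halts_step halts_Store halts_Query halts_Cond halts_Skip) auto
    next
      case False
      then have "I (Suc i) (r(5 := 0)) (m(i := 1, i := 0))"
        unfolding I_def old using S by (auto simp: less_Suc_eq)
      then show ?thesis using i S False new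
        by (intro halts_step halts_Store halts_Query halts_Cond halts_Skip) auto
    qed
  qed
  have "halts orc greedy (r, \<lambda>_. 0) (n * (Suc (Suc (Suc 1)) + 3) + 3)
      (\<lambda>(r', m'). I n r' m' \<and> r' 0 = n \<and> r' 2 = 1)"
    unfolding greedy_def using init emp
    by (intro halts_for_loop body) (auto simp: I_def)
  then show ?thesis by (rule halts_weaken) (auto simp: I_def)
qed

definition edge_formula :: "nat \<Rightarrow> nat \<Rightarrow> formula" where
  "edge_formula x y = Conj (Mem x) (Conj (Neg (Mem y)) (Exch x y))"

definition incomplete_formula :: formula where
  "incomplete_formula = Exists (Exists (Exists (Exists
     (Conj (edge_formula 0 1) (Conj (edge_formula 2 3) (Neg (edge_formula 0 3)))))))"

definition star_formula :: formula where
  "star_formula = Exists (Exists (Conj (edge_formula 0 1) (Neg (Exists (Exists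
     (Conj (edge_formula 2 3) (Conj (Neg (Equal 2 0)) (Neg (Equal 3 1)))))))))"

definition shape_formula :: formula where
  "shape_formula = Neg (Conj incomplete_formula (Neg star_formula))"

definition decide_separable :: com where
  "decide_separable = Seq (Const 1 0) (Seq (Const 2 1) (Seq greedy
     (Seq (compile 0 shape_formula) (Move 0 (result_reg 0)))))"

text \<open>
  The greedy phase takes at most \<open>7 n + 3\<close> steps; the other 3 set the constants and deliver the answer.
\<close>

definition step_bound :: "nat poly" where
  "step_bound = cost shape_formula + [:6, 7:]"

lemma halts_decide:
  assumes anti: "\<And>I J. I \<subseteq> J \<Longrightarrow> orc J \<Longrightarrow> orc I" and emp: "orc {}"
  shows "\<exists>S. S \<subseteq> {..<n} \<and> orc S \<and> (\<forall>j<n. j \<notin> S \<longrightarrow> \<not> orc (insert j S)) \<and>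
    halts orc decide_separable (input n k) (poly step_bound n)
       (\<lambda>s. answer s = (if holds orc n S 0 shape_formula e then 1 else 0))"
proof -
  define max_indep where "max_indep S \<longleftrightarrow> S \<subseteq> {..<n} \<and> orc S \<and> (\<forall>j<n. j \<notin> S \<longrightarrow> \<not> orc (insert j S))" for S
  let ?good = "\<lambda>S s. answer s = (if holds orc n S 0 shape_formula e then 1 else 0)"
  obtain r0 :: "nat \<Rightarrow> nat" where r0: "input n k = (r0, \<lambda>_. 0)" "r0 0 = n" by (simp add: input_def)
  define r1 where "r1 = r0(1 := 0, 2 := 1)"
  have last: "halts orc (Seq (compile 0 shape_formula) (Move 0 (result_reg 0))) (r, m) (poly (cost shape_formula) n + 1) (?good {i. m i \<noteq> 0})"
    if "r 0 = n" "r 1 = 0" "r 2 = 1" for r m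
  proof (rule halts_Seq)
    show "halts orc (compile 0 shape_formula) (r, m) (poly (cost shape_formula) n)
        (evaluated 0 r m (holds orc n {i. m i \<noteq> 0} 0 shape_formula e))"
      using that
      by (intro halts_compile) (auto simp: shape_formula_def incomplete_formula_def star_formula_def edge_formula_def)
    fix s assume "evaluated 0 r m (holds orc n {i. m i \<noteq> 0} 0 shape_formula e) s"
    then show "halts orc (Move 0 (result_reg 0)) s 1 (?good {i. m i \<noteq> 0})"
      by (cases s) (auto simp: evaluated_def answer_def intro!: halts_Move)
  qed simp
  have "halts orc greedy (r1, \<lambda>_. 0) (n * 7 + 3) (\<lambda>(r', m'). r' 0 = n \<and> r' 1 = 0 \<and> r' 2 = 1 \<and> max_indep {i. m' i \<noteq> 0})"
    unfolding max_indep_def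
    by (rule halts_greedy, erule anti, assumption, rule emp) (use r0(2) in \<open>simp_all add: r1_def\<close>)
  then have "halts orc (Seq greedy (Seq (compile 0 shape_formula) (Move 0 (result_reg 0)))) (r1, \<lambda>_. 0)
      (n * 7 + 3 + (poly (cost shape_formula) n + 1)) (\<lambda>s. \<exists>S. max_indep S \<and> ?good S s)"
  proof (rule halts_Seq)
    fix s' :: state
    assume "case s' of (r', m') \<Rightarrow> r' 0 = n \<and> r' 1 = 0 \<and> r' 2 = 1 \<and> max_indep {i. m' i \<noteq> 0}"
    then obtain r m where s': "s' = (r, m)" "r 0 = n" "r 1 = 0" "r 2 = 1" "max_indep {i. m i \<noteq> 0}"
      by (cases s') auto
    show "halts orc (Seq (compile 0 shape_formula) (Move 0 (result_reg 0))) s' (poly (cost shape_formula) n + 1)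
        (\<lambda>s. \<exists>S. max_indep S \<and> ?good S s)"
      unfolding s'(1) using s'(5) by (intro halts_weaken[OF last[OF s'(2-4)]]) blast+
  qed simp
  then have "halts orc decide_separable (input n k) (Suc (Suc (n * 7 + 3 + (poly (cost shape_formula) n + 1))))
      (\<lambda>s. \<exists>S. max_indep S \<and> ?good S s)"
    unfolding decide_separable_def r0(1) r1_def by (intro halts_step halts_Const) auto
  then obtain t q s S where S: "max_indep S"
    and run: "exec orc decide_separable (input n k) t q s" "?good S s"
    and t: "t \<le> Suc (Suc (n * 7 + 3 + (poly (cost shape_formula) n + 1)))"
    unfolding halts_def by blast
  have "t \<le> poly step_bound n" using t by (simp add: step_bound_def)
  then have "halts orc decide_separable (input n k) (poly step_bound n) (?good S)"
    unfolding halts_def using run by blast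
  with S show ?thesis unfolding max_indep_def by (intro exI[of _ S]) simp
qed

lemma holds_edge_formula:
  "holds orc n S l (edge_formula x y) e \<longleftrightarrow> e x \<in> S \<and> e y \<notin> S \<and> orc (insert (e y) (S - {e x}))"
  by (auto simp: edge_formula_def)

lemma holds_shape_formula:
  fixes orc n S
  defines "D i j \<equiv> i \<in> S \<and> j \<notin> S \<and> orc (insert j (S - {i}))"
  shows "holds orc n S 0 shape_formula e \<longleftrightarrow>
     (\<forall>i<n. \<forall>j<n. \<forall>i'<n. \<forall>j'<n. D i j \<longrightarrow> D i' j' \<longrightarrow> D i j') \<or>
     (\<exists>p<n. \<exists>a<n. D p a \<and> (\<forall>i<n. \<forall>j<n. D i j \<longrightarrow> i = p \<or> j = a))"
  unfolding shape_formula_def incomplete_formula_def star_formula_def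
  by (simp add: holds_edge_formula eval_nat_numeral flip: D_def) blast

lemma independence_oracle_image:
  assumes "I \<subseteq> {..<length ws}"
  shows "independence_oracle ws H I \<longleftrightarrow> indep_set H ((!) ws ` I)"
proof -
  have "{ws ! i | i. i \<in> I \<and> i < length ws} = (!) ws ` I" using assms by auto
  then show ?thesis by (simp add: independence_oracle_def)
qed

lemma independence_oracle_antimono:
  assumes "I \<subseteq> J" "independence_oracle ws H J"
  shows "independence_oracle ws H I"
proof -
  have "{ws ! i | i. i \<in> I \<and> i < length ws} \<subseteq> {ws ! i | i. i \<in> J \<and> i < length ws}"
    using assms(1) by blast
  then show ?thesis
    using assms(2) unfolding independence_oracle_def indep_set_def by (meson subset_trans)
qed

lemma maximal_indep_in_H:
  assumes M: "k_matroid k W H" and ind: "indep_set H B"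
    and max: "\<And>v. v \<in> W \<Longrightarrow> v \<notin> B \<Longrightarrow> \<not> indep_set H (insert v B)"
  shows "B \<in> H"
proof -
  from ind obtain E where E: "E \<in> H" "B \<subseteq> E" unfolding indep_set_def by blast
  have "E \<subseteq> B"
  proof
    fix v assume v: "v \<in> E"
    then have "v \<in> W" using k_matroidD(1)[OF M E(1)] by auto
    moreover have "indep_set H (insert v B)" using E v unfolding indep_set_def by auto
    ultimately show "v \<in> B" using max by blast
  qed
  with E show ?thesis by (simp add: subset_antisym)
qed

lemma indep_of_card:
  assumes M: "k_matroid k W H" and "indep_set H I" "card I = k"
  shows "I \<in> H"
proof -
  from assms(2) obtain E where E: "E \<in> H" "I \<subseteq> E" unfolding indep_set_def by blast
  have "I = E" using card_subset_eq[of E I] E k_matroidD[OF M E(1)] assms(3) by simp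
  with E show ?thesis by simp
qed

text \<open>
  The program works with positions in \<open>ws\<close>, on which \<open>nth ws\<close> is a bijection to \<open>W\<close>. Quantifying
  over positions is as good as quantifying over all elements, since the ends of an edge lie in \<open>W\<close>.
\<close>

lemma holds_shape_formula_iff_separable:
  assumes ws: "distinct ws" "set ws = W" and k: "0 < k"
    and M: "k_matroid k W H" and bin: "binary_matroid W H"
    and S: "S \<subseteq> {..<length ws}" "independence_oracle ws H S"
      "\<forall>j<length ws. j \<notin> S \<longrightarrow> \<not> independence_oracle ws H (insert j S)"
  shows "holds (independence_oracle ws H) (length ws) S 0 shape_formula e \<longleftrightarrow> separable_hypergraph k W H"
proof -
  define B where "B = (!) ws ` S"
  define n where "n = length ws"
  have inj: "inj_on ((!) ws) {..<n}" using ws(1) by (auto simp: inj_on_nth n_def)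
  have W: "W = (!) ws ` {..<n}" using ws(2) by (auto simp: set_conv_nth n_def)
  have memB: "ws ! i \<in> B \<longleftrightarrow> i \<in> S" if "i < n" for i
    using inj_on_image_mem_iff[OF inj, of i S] that S(1) by (simp add: B_def n_def)
  have BH: "B \<in> H"
  proof (rule maximal_indep_in_H[OF M])
    show "indep_set H B" using S(1,2) by (simp add: independence_oracle_image B_def)
    fix v assume "v \<in> W" "v \<notin> B"
    then obtain j where j: "v = ws ! j" "j < n" "j \<notin> S" using W memB by auto
    then show "\<not> indep_set H (insert v B)"
      using S(3)[rule_format, of j] independence_oracle_image[of "insert j S" ws H] S(1)
      by (simp add: B_def n_def)
  qed
  define D where "D i j \<longleftrightarrow> i \<in> S \<and> j \<notin> S \<and> independence_oracle ws H (insert j (S - {i}))" for i j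
  have D: "D i j \<longleftrightarrow> fundamental_edge H B (ws ! i) (ws ! j)" if ij: "i < n" "j < n" for i j
  proof (cases "i \<in> S \<and> j \<notin> S")
    case True
    have "(!) ws ` (S - {i}) = B - {ws ! i}"
      using inj_on_image_set_diff[OF inj, of S "{i}"] S(1) ij by (auto simp: B_def n_def)
    then have "independence_oracle ws H (insert j (S - {i}))
        \<longleftrightarrow> indep_set H (insert (ws ! j) (B - {ws ! i}))"
      using independence_oracle_image[of "insert j (S - {i})" ws H] S(1) ij
      by (auto simp: n_def)
    also have "\<dots> \<longleftrightarrow> insert (ws ! j) (B - {ws ! i}) \<in> H"
    proof
      assume "indep_set H (insert (ws ! j) (B - {ws ! i}))"
      moreover have "card (insert (ws ! j) (B - {ws ! i})) = k"
        using True memB ij k_matroidD[OF M BH] card_swap[of B "ws ! i" "ws ! j"] by metis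
      ultimately show "insert (ws ! j) (B - {ws ! i}) \<in> H" by (rule indep_of_card[OF M])
    qed (auto simp: indep_set_def)
    finally show ?thesis using True memB ij by (simp add: D_def fundamental_edge_def)
  qed (use memB ij in \<open>auto simp: D_def fundamental_edge_def\<close>)
  have edgeE: "\<exists>i<n. \<exists>j<n. b = ws ! i \<and> f = ws ! j" if bf: "fundamental_edge H B b f" for b f
  proof -
    have "b \<in> W" using bf k_matroidD(1)[OF M BH] by (auto simp: fundamental_edge_def)
    moreover have "insert f (B - {b}) \<subseteq> W" using bf k_matroidD(1)[OF M, of "insert f (B - {b})"] by (simp add: fundamental_edge_def)
    ultimately show ?thesis unfolding W by auto
  qed
  have eq: "ws ! i = ws ! j \<longleftrightarrow> i = j" if "i < n" "j < n" for i j
    using that ws(1) by (simp add: nth_eq_iff_index_eq n_def)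
  have "complete_edges H B \<longleftrightarrow>
      (\<forall>i<n. \<forall>j<n. \<forall>i'<n. \<forall>j'<n. D i j \<longrightarrow> D i' j' \<longrightarrow> D i j')" (is "_ \<longleftrightarrow> ?complete")
  proof
    assume "complete_edges H B"
    then show ?complete unfolding complete_edges_def by (simp add: D) blast
  next
    assume c: ?complete
    show "complete_edges H B" unfolding complete_edges_def
    proof (intro allI impI)
      fix b f b' f' assume e: "fundamental_edge H B b f" "fundamental_edge H B b' f'"
      obtain i j where ij: "i < n" "j < n" "b = ws ! i" "f = ws ! j" using edgeE[OF e(1)] by auto
      obtain i' j' where ij': "i' < n" "j' < n" "b' = ws ! i'" "f' = ws ! j'" using edgeE[OF e(2)] by auto
      have "D i j'" using c e ij ij' D by metis
      then show "fundamental_edge H B b f'" using ij ij' D by simp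
    qed
  qed
  moreover have "double_star H B \<longleftrightarrow>
      (\<exists>p<n. \<exists>a<n. D p a \<and> (\<forall>i<n. \<forall>j<n. D i j \<longrightarrow> i = p \<or> j = a))" (is "_ \<longleftrightarrow> ?star")
  proof
    assume "double_star H B"
    then obtain b f where bf: "fundamental_edge H B b f" and all: "\<And>b' f'. fundamental_edge H B b' f' \<Longrightarrow> b' = b \<or> f' = f"
      unfolding double_star_def by blast
    obtain p a where pa: "p < n" "a < n" "b = ws ! p" "f = ws ! a" using edgeE[OF bf] by auto
    have "D p a" using bf pa D by simp
    moreover have "i = p \<or> j = a" if "i < n" "j < n" "D i j" for i j
      using all[of "ws ! i" "ws ! j"] that pa D eq by simp
    ultimately show ?star using pa by blast
  next
    assume ?star
    then obtain p a where pa: "p < n" "a < n" "D p a"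
      and all: "\<And>i j. i < n \<Longrightarrow> j < n \<Longrightarrow> D i j \<Longrightarrow> i = p \<or> j = a" by blast
    have "b = ws ! p \<or> f = ws ! a" if bf: "fundamental_edge H B b f" for b f
    proof -
      obtain i j where ij: "i < n" "j < n" "b = ws ! i" "f = ws ! j" using edgeE[OF bf] by auto
      then show ?thesis using all[of i j] bf D by auto
    qed
    moreover have "fundamental_edge H B (ws ! p) (ws ! a)" using pa D by simp
    ultimately show "double_star H B" unfolding double_star_def by blast
  qed
  moreover have "holds (independence_oracle ws H) n S 0 shape_formula e \<longleftrightarrow> ?complete \<or> ?star"
    unfolding D_def by (rule holds_shape_formula)
  ultimately show ?thesis using separable_iff_shape[OF M bin k BH] by (simp add: n_def)
qed

theorem mainTheorem10:
  "\<exists>(alg :: com) (time_bound :: nat poly) (query_bound :: nat poly).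
     \<forall>(W :: nat set) (k :: nat) (H :: nat set set) (ws :: nat list).
       finite W \<and> distinct ws \<and> set ws = W \<and> 1 \<le> k \<and> k < card W \<and>
       k_matroid k W H \<and> binary_matroid W H \<longrightarrow>
       (\<exists>t q s. exec (independence_oracle ws H) alg (input (card W) k) t q s \<and>
          answer s = (if separable_hypergraph k W H then 1 else 0) \<and>
          t \<le> poly time_bound (card W) \<and>
          q \<le> poly query_bound (card W))"
proof (rule exI[of _ decide_separable], intro exI[of _ step_bound] allI impI, elim conjE)
  fix W :: "nat set" and k :: nat and H :: "nat set set" and ws :: "nat list"
  assume ws: "distinct ws" "set ws = W" and k: "1 \<le> k"
    and M: "k_matroid k W H" and bin: "binary_matroid W H"
  let ?orc = "independence_oracle ws H" and ?e = "\<lambda>_. 0 :: nat"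
  have n: "card W = length ws" using ws distinct_card by blast
  have "H \<noteq> {}" using M by (simp add: k_matroid_def)
  then have empty: "?orc {}" by (auto simp: independence_oracle_def indep_set_def)
  have "\<exists>S. S \<subseteq> {..<length ws} \<and> ?orc S \<and> (\<forall>j<length ws. j \<notin> S \<longrightarrow> \<not> ?orc (insert j S)) \<and>
      halts ?orc decide_separable (input (length ws) k) (poly step_bound (length ws))
        (\<lambda>s. answer s = (if holds ?orc (length ws) S 0 shape_formula ?e then 1 else 0))"
    by (rule halts_decide, erule independence_oracle_antimono, assumption, rule empty)
  then obtain S where S: "S \<subseteq> {..<length ws}" "?orc S"
      "\<forall>j<length ws. j \<notin> S \<longrightarrow> \<not> ?orc (insert j S)"
    and run: "halts ?orc decide_separable (input (length ws) k) (poly step_bound (length ws))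
       (\<lambda>s. answer s = (if holds ?orc (length ws) S 0 shape_formula ?e then 1 else 0))"
    by (elim exE conjE)
  have "holds ?orc (length ws) S 0 shape_formula ?e \<longleftrightarrow> separable_hypergraph k W H"
    using k by (intro holds_shape_formula_iff_separable[OF ws _ M bin S]) auto
  then have "halts ?orc decide_separable (input (length ws) k) (poly step_bound (length ws))
      (\<lambda>s. answer s = (if separable_hypergraph k W H then 1 else 0))"
    using run by (simp only:)
  then obtain t q s where "exec ?orc decide_separable (input (length ws) k) t q s"
    "t \<le> poly step_bound (length ws)" "answer s = (if separable_hypergraph k W H then 1 else 0)"
    unfolding halts_def by (elim exE conjE)
  moreover from this have "q \<le> poly step_bound (length ws)"
    using queries_le_steps le_trans by blast
  ultimately show "\<exists>t q s. exec ?orc decide_separable (input (card W) k) t q s \<and>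
          answer s = (if separable_hypergraph k W H then 1 else 0) \<and>
          t \<le> poly step_bound (card W) \<and> q \<le> poly step_bound (card W)"
    unfolding n by blast
qed

end
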